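(* Let $p\in\mathbb{R}$ and consider the ordinary differential equation $$h^{1-p}(h'^2+h^2)^{-1}(h''+h)=1\quad\text{on }\mathbb{S}^1. \qquad ( ** )$$ (a) When $-1<p<0$, equation $( ** )$ has exactly two solutions (up to rotation), of which one is the constant solution and the other is a positive smooth non-constant solution. (b) When $-4\le p\le -1$, equation $( ** )$ has only one solution, which is just the constant solution. (c) When $p<-4$, equation $( ** )$ admits at least $\lceil\sqrt{-p}\,\rceil-2$ non-constant positive smooth solutions (up to rotation), where $\lceil\sqrt{-p}\,\rceil$ is the smallest integer that is greater than or equal to $\sqrt{-p}$.
   Context: The unit circle $\mathbb{S}^1$ is parametrized by arc length $\theta\in[0,2\pi]$, so functions on $\mathbb{S}^1$ are $2\pi$-periodic functions of $\theta$; the superscript $'$ denotes $\frac{d}{d\theta}$. A solution is a positive $C^2$ function $h:\mathbb{S}^1\to(0,\infty)$ satisfying the equation at every point (such a solution is automatically smooth). Two solutions are identified up to rotation if $h_2(\theta)=h_1(\theta+c)$ for some constant $c$; "at least $N$ solutions up to rotation" means at least $N$ solutions no two of which are rotations of each other. The constant solution is $h\equiv1$. *)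

theory Defs
  imports "HOL-Analysis.Analysis"
begin

text \<open>Functions on the unit circle are rendered as \<open>2 * pi\<close>-periodic functions of the
  arc-length parameter, so \<open>deriv\<close> is the derivative with respect to arc length.\<close>

definition on_circle :: "(real \<Rightarrow> real) \<Rightarrow> bool" where
  "on_circle h \<longleftrightarrow> (\<forall>\<theta>. h (\<theta> + 2 * pi) = h \<theta>)"

text \<open>Differentiability is required explicitly at every order below \<open>k\<close>, because \<open>deriv\<close>
  also has a value where a function is not differentiable.\<close>

definition C_class :: "nat \<Rightarrow> (real \<Rightarrow> real) \<Rightarrow> bool" where
  "C_class k h \<longleftrightarrow>
     (\<forall>j<k. \<forall>\<theta>. (deriv ^^ j) h differentiable (at \<theta>)) \<and> continuous_on UNIV ((deriv ^^ k) h)"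

definition smooth :: "(real \<Rightarrow> real) \<Rightarrow> bool" where
  "smooth h \<longleftrightarrow> (\<forall>k. C_class k h)"

definition solutions :: "real \<Rightarrow> (real \<Rightarrow> real) set" where
  "solutions p = {h. on_circle h \<and> C_class 2 h \<and> (\<forall>\<theta>. h \<theta> > 0) \<and>
     (\<forall>\<theta>. h \<theta> powr (1 - p) * inverse ((deriv h \<theta>)\<^sup>2 + (h \<theta>)\<^sup>2) * (deriv (deriv h) \<theta> + h \<theta>) = 1)}"

definition rotation :: "((real \<Rightarrow> real) \<times> (real \<Rightarrow> real)) set" where
  "rotation = {(h\<^sub>1, h\<^sub>2). \<exists>c. \<forall>\<theta>. h\<^sub>2 \<theta> = h\<^sub>1 (\<theta> + c)}"

lemma equiv_rotation: "equiv UNIV rotation"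
proof (rule equivI)
  show "rotation \<subseteq> UNIV \<times> UNIV" by simp
  show "refl rotation"
    by (auto simp: refl_on_def rotation_def intro: exI[of _ 0])
  show "sym rotation"
  proof (rule symI)
    fix f g assume "(f, g) \<in> rotation"
    then obtain c where c: "\<And>\<theta>. g \<theta> = f (\<theta> + c)" by (auto simp: rotation_def)
    have "\<forall>\<theta>. f \<theta> = g (\<theta> + - c)" by (simp add: c)
    then show "(g, f) \<in> rotation" unfolding rotation_def by blast
  qed
  show "trans rotation"
  proof (rule transI)
    fix f g h assume "(f, g) \<in> rotation" "(g, h) \<in> rotation"
    then obtain c d where "\<And>\<theta>. g \<theta> = f (\<theta> + c)" "\<And>\<theta>. h \<theta> = g (\<theta> + d)"
      by (auto simp: rotation_def)
    then have "\<forall>\<theta>. h \<theta> = f (\<theta> + (d + c))" by (simp add: add.assoc)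
    then show "(f, h) \<in> rotation" unfolding rotation_def by blast
  qed
qed

lemma one_in_solutions: "(\<lambda>_. 1) \<in> solutions p"
proof -
  have d: "deriv (\<lambda>_::real. c) = (\<lambda>_. 0)" for c :: real by (rule ext) simp
  have "(deriv ^^ j) (\<lambda>_::real. 1::real) = (if j = 0 then (\<lambda>_. 1) else (\<lambda>_. 0))" for j
    by (induction j) (simp_all add: d)
  then have "C_class k (\<lambda>_. 1)" for k by (simp add: C_class_def)
  then show ?thesis by (simp add: solutions_def on_circle_def d)
qed

end

theory Submission
  imports Defs "HOL-Real_Asymp.Real_Asymp"
begin

text \<open>
  With \<open>a = - p\<close> and \<open>u = ln h\<close> the equation reads \<open>u'' = (exp (- a u) - 1) (1 + u'\<^sup>2)\<close>, an oscillator
  with first integral \<open>ln (1 + u'\<^sup>2) / 2 + m / a\<close>, where \<open>m = exp (- a u) - 1 + a u\<close>. In the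
  coordinates \<open>C = sgn u * sqrt (exp (2 m / a) - 1)\<close> and \<open>D = - u' * sqrt (1 + C\<^sup>2)\<close> every orbit is a
  circle of some radius \<open>r\<close>, traversed with angular speed \<open>1 / density C\<close>. Hence the nonconstant
  solutions are the orbits for which \<open>2 pi\<close> is a multiple of the period, and the period is
  the integral over half the circle of \<open>N C = density C + density (- C)\<close>.

  Let \<open>s < 1 < t\<close> be the two values of \<open>exp (- a u)\<close> on the level \<open>m\<close>, i.e. the two roots of
  \<open>x - ln x = 1 + m\<close>. Then \<open>N = sqrt (1 - exp (- 2 m / a)) * (\<alpha> + \<beta>)\<close> with \<open>\<alpha> = 1 / (t - 1)\<close>,
  \<open>\<beta> = 1 / (1 - s)\<close>. Since \<open>\<alpha>\<close> and \<open>\<beta>\<close> satisfy polynomial differential equations in \<open>m\<close>, the function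
  \<open>V = 1 / (\<alpha> + \<beta>)\<^sup>2\<close> satisfies \<open>2 V' < 1 - V\<close> and \<open>V'' + 2 V' > 0\<close>. The first inequality gives \<open>N > 1\<close>,
  so that the period exceeds \<open>pi\<close>, for \<open>a \<le> 4\<close>; the second makes \<open>N\<close> decreasing for \<open>a \<le> 1\<close> and
  bounds it by \<open>2\<close> for \<open>a \<ge> 1\<close>. The period tends to \<open>2 pi / sqrt a\<close> at small radius, and at large radius
  it approaches \<open>pi\<close> from above, so the intermediate value theorem produces the solutions.
\<close>

section \<open>Real functions\<close>

text \<open>Serves twice: to invert \<open>coord\<close> into \<open>height\<close> and
  \<open>clock\<close> into \<open>angle\<close>.\<close>

lemma inv_has_real_derivative:
  fixes f f' :: "real \<Rightarrow> real"
  assumes deriv: "\<And>x. (f has_real_derivative f' x) (at x)"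
    and pos: "\<And>x. 0 < f' x" and "surj f"
  shows "strict_mono f" and "(inv f has_real_derivative inverse (f' (inv f y))) (at y)"
proof -
  show mono: "strict_mono f"
    by (rule strict_monoI) (metis DERIV_pos_imp_increasing deriv pos)
  then have inj: "inj f"
    by (rule strict_mono_imp_inj_on)
  have fg: "f (inv f z) = z" for z
    using \<open>surj f\<close> by (simp add: surj_f_inv_f)
  have "isCont (inv f) (f (inv f y))"
    by (rule isCont_inverse_function[where d = 1])
      (auto simp: inj intro: DERIV_isCont[OF deriv])
  then have "isCont (inv f) y"
    by (simp add: fg)
  then show "(inv f has_real_derivative inverse (f' (inv f y))) (at y)"
    by (intro DERIV_inverse_function[where f = f and a = "y - 1" and b = "y + 1"])
      (use deriv pos[of "inv f y"] fg in auto)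
qed

text \<open>The device behind the differential inequalities in the amplitude, where the start value
  at 0 exists only as a one-sided limit. Inserting the point \<open>x / 2\<close> keeps the
  inequality strict after passing to the limit.\<close>

lemma gt_limit_at_right_0:
  fixes f f' :: "real \<Rightarrow> real"
  assumes "\<And>x. 0 < x \<Longrightarrow> (f has_real_derivative f' x) (at x)" "\<And>x. 0 < x \<Longrightarrow> 0 < f' x"
    and lim: "(f \<longlongrightarrow> l) (at_right 0)" and "0 < x"
  shows "l < f x"
proof -
  have mono: "f y < f z" if "0 < y" "y < z" for y z
    using assms(1,2) that by (intro DERIV_pos_imp_increasing[OF \<open>y < z\<close>]) (meson less_le_trans)
  have "\<forall>\<^sub>F y in at_right 0. f y \<le> f (x / 2)"
    unfolding eventually_at_right_field
    by (rule exI[of _ "x / 2"]) (use mono \<open>0 < x\<close> in \<open>auto simp: less_imp_le\<close>)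
  then have "l \<le> f (x / 2)"
    using tendsto_upperbound[OF lim] by simp
  also have "\<dots> < f x"
    using mono[of "x / 2" x] \<open>0 < x\<close> by simp
  finally show ?thesis .
qed

lemma sqrt_one_plus_square_pos: "0 < sqrt (1 + x\<^sup>2)" for x :: real
  by (simp add: add_pos_nonneg)

lemma one_plus_square_pos: "0 < 1 + x\<^sup>2" for x :: real
  by (simp add: add_pos_nonneg)

lemma exists_antiderivative:
  fixes f :: "real \<Rightarrow> real"
  assumes "\<And>x. isCont f x"
  shows "\<exists>F. F 0 = c \<and> (\<forall>x. (F has_real_derivative f x) (at x))"
proof -
  have "\<exists>F. \<forall>x. -\<infinity> < ereal x \<longrightarrow> ereal x < \<infinity> \<longrightarrow> (F has_vector_derivative f x) (at x)"
    by (rule einterval_antiderivative) (use assms in auto)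
  then obtain F where F: "\<And>x. (F has_real_derivative f x) (at x)"
    by (auto simp: has_real_derivative_iff_has_vector_derivative)
  have "((\<lambda>x. F x - F 0 + c) has_real_derivative f x) (at x)" for x
    by (auto intro!: derivative_eq_intros F)
  then show ?thesis
    by (intro exI[of _ "\<lambda>x. F x - F 0 + c"]) auto
qed

lemma zero_derivative_const:
  fixes f :: "real \<Rightarrow> real"
  assumes "\<And>x. (f has_real_derivative 0) (at x)"
  shows "f x = f y"
  by (rule DERIV_isconst_all) (simp add: assms)

text \<open>Smoothness by bootstrapping: this class is closed under differentiation along the flow.\<close>

inductive_set jets :: "(real \<Rightarrow> real) \<Rightarrow> (real \<Rightarrow> real) \<Rightarrow> (real \<Rightarrow> real) set" for u u' where
  const: "(\<lambda>_. c) \<in> jets u u'"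
| slope: "(\<lambda>t. u' t) \<in> jets u u'"
| exp: "(\<lambda>t. exp (c * u t)) \<in> jets u u'"
| add: "f \<in> jets u u' \<Longrightarrow> g \<in> jets u u' \<Longrightarrow> (\<lambda>t. f t + g t) \<in> jets u u'"
| mult: "f \<in> jets u u' \<Longrightarrow> g \<in> jets u u' \<Longrightarrow> (\<lambda>t. f t * g t) \<in> jets u u'"

lemma smooth_if_closed_under_deriv:
  assumes closed: "\<And>f. f \<in> F \<Longrightarrow> \<exists>f'\<in>F. \<forall>x. (f has_real_derivative f' x) (at x)"
    and "f \<in> F"
  shows "smooth f"
proof -
  have "deriv g \<in> F" if g: "g \<in> F" for g
  proof -
    obtain g' where "g' \<in> F" "\<And>x. (g has_real_derivative g' x) (at x)"
      using closed[OF g] by blast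
    moreover from this(2) have "deriv g = g'"
      by (intro ext DERIV_imp_deriv)
    ultimately show ?thesis by simp
  qed
  then have mem: "(deriv ^^ j) f \<in> F" for j
    by (induction j) (simp_all add: \<open>f \<in> F\<close>)
  have "(deriv ^^ j) f differentiable (at x)" for j x
    using closed[OF mem] by (meson real_differentiable_def)
  then show ?thesis
    unfolding smooth_def C_class_def
    by (auto intro!: continuous_at_imp_continuous_on differentiable_imp_continuous_within)
qed

section \<open>The two roots of x - ln x\<close>

text \<open>Both monotone branches come from the strict bound \<open>ln z < z - 1\<close>, applied
  to the ratios \<open>x / y\<close> and \<open>y / x\<close>.\<close>

lemma id_minus_ln_less:
  fixes x y :: real
  assumes "0 < x" "x < y"
  shows "y \<le> 1 \<Longrightarrow> y - ln y < x - ln x" and "1 \<le> x \<Longrightarrow> x - ln x < y - ln y"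
proof -
  have ln: "ln (x / y) = ln x - ln y" "ln (y / x) = ln y - ln x"
    using assms by (simp_all add: ln_div)
  have xy: "ln (x / y) < x / y - 1"
    using ln_le_minus_one[of "x / y"] ln_eq_minus_one[of "x / y"] assms
    by (auto simp: less_le)
  have yx: "ln (y / x) < y / x - 1"
    using ln_le_minus_one[of "y / x"] ln_eq_minus_one[of "y / x"] assms
    by (auto simp: less_le)
  show "y - ln y < x - ln x" if "y \<le> 1"
  proof -
    have "(y - x) * 1 \<le> (y - x) * (1 / y)"
      using assms that by (intro mult_left_mono) auto
    then have "y - x \<le> 1 - x / y"
      using assms by (simp add: diff_divide_distrib)
    then show ?thesis using xy ln by linarith
  qed
  show "x - ln x < y - ln y" if "1 \<le> x"
  proof -
    have "(y - x) * (1 / x) \<le> (y - x) * 1"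
      using assms that by (intro mult_left_mono) auto
    then have "y / x - 1 \<le> y - x"
      using assms by (simp add: diff_divide_distrib)
    then show ?thesis using yx ln by linarith
  qed
qed

text \<open>The difference of the two sides vanishes at 1 and has derivative
  \<open>- ((1 / s - 1)\<^sup>2)\<close>. It will place the larger root below the reciprocal of the
  smaller one.\<close>

lemma id_minus_ln_inverse_greater:
  fixes s :: real
  assumes "0 < s" "s < 1"
  shows "s - ln s < 1 / s - ln (1 / s)"
proof -
  define f where "f = (\<lambda>s :: real. 1 / s - s + 2 * ln s)"
  have "f 1 < f s"
  proof (rule DERIV_neg_imp_decreasing_open[OF \<open>s < 1\<close>])
    fix x assume x: "s < x" "x < 1"
    have "(f has_real_derivative - ((1 / x - 1)\<^sup>2)) (at x)"
      unfolding f_def using x assms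
      by (auto intro!: derivative_eq_intros simp: field_simps power2_eq_square)
    then show "\<exists>y. (f has_real_derivative y) (at x) \<and> y < 0"
      using x assms by (intro exI conjI) auto
  qed (use assms in \<open>auto simp: f_def intro!: continuous_intros\<close>)
  then show ?thesis
    using assms by (simp add: f_def ln_div)
qed

text \<open>The Moebius transform of \<open>x\<close> is the \<open>s\<close> with \<open>1 / (1 - s) = 1 / x + 1 / 2\<close>.\<close>

lemma id_minus_ln_moebius_greater:
  fixes x :: real
  assumes "0 < x" "x < 2"
  shows "(1 + x) - ln (1 + x) < (2 - x) / (2 + x) - ln ((2 - x) / (2 + x))"
proof -
  \<comment> \<open>\<open>f\<close> is the right side minus the left side, shifted by the constant
    2, and \<open>f 0 = 2\<close>.\<close>
  define f where "f = (\<lambda>x :: real. 4 / (2 + x) - ln (2 - x) + ln (2 + x) - x + ln (1 + x))"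
  have "f 0 < f x"
  proof (rule DERIV_pos_imp_increasing_open[OF \<open>0 < x\<close>])
    fix y assume y: "0 < y" "y < x"
    have deriv: "(f has_real_derivative
        - 4 / (2 + y)\<^sup>2 + 1 / (2 - y) + 1 / (2 + y) - 1 + 1 / (1 + y)) (at y)"
      unfolding f_def using y assms
      by (auto intro!: derivative_eq_intros simp: power2_eq_square)
    have "- 4 / (2 + y)\<^sup>2 + 1 / (2 - y) + 1 / (2 + y) - 1 + 1 / (1 + y)
        = y * (4 * y + 2 * y\<^sup>2 + y ^ 3) / ((2 + y)\<^sup>2 * (2 - y) * (1 + y))"
      using y assms by (simp add: divide_simps) (simp add: algebra_simps power2_eq_square power3_eq_cube)
    also have "\<dots> > 0"
      using y assms by (intro divide_pos_pos mult_pos_pos add_pos_pos) auto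
    finally show "\<exists>z. (f has_real_derivative z) (at y) \<and> 0 < z"
      using deriv by blast
  qed (use assms in \<open>auto simp: f_def intro!: continuous_intros\<close>)
  moreover have "(2 - x) / (2 + x) = 4 / (2 + x) - 1"
    using assms by (simp add: field_simps)
  moreover have "ln ((2 - x) / (2 + x)) = ln (2 - x) - ln (2 + x)"
    using assms by (simp add: ln_div)
  ultimately show ?thesis
    unfolding f_def by simp
qed

text \<open>Monotonicity on either side of 1 turns comparisons of values into comparisons of points.
  The upper bound amounts to \<open>s * t < 1\<close>; the lower one fails only if \<open>s\<close>
  is at most the Moebius transform of \<open>t - 1\<close>.\<close>

lemma id_minus_ln_roots:
  fixes s t :: real
  assumes "0 < s" "s < 1" "1 < t" and eq: "s - ln s = t - ln t"
  shows "1 / (1 - s) - 1 / (t - 1) < 1" and "1 / 2 < 1 / (1 - s) - 1 / (t - 1)"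
proof -
  have "t < 1 / s"
  proof (rule ccontr)
    assume "\<not> t < 1 / s"
    then have "1 / s - ln (1 / s) \<le> t - ln t"
      using id_minus_ln_less(2)[of "1 / s" t] assms by fastforce
    then show False
      using id_minus_ln_inverse_greater[of s] assms by simp
  qed
  then have "s * t < 1"
    using assms by (simp add: field_simps)
  then have "1 / (1 - s) < t / (t - 1)"
    using assms by (simp add: field_simps)
  also have "t / (t - 1) = 1 + 1 / (t - 1)"
    using assms by (simp add: field_simps)
  finally show "1 / (1 - s) - 1 / (t - 1) < 1"
    by simp
  show "1 / 2 < 1 / (1 - s) - 1 / (t - 1)"
  proof (rule ccontr)
    define x where "x = t - 1"
    have x: "0 < x" using assms by (simp add: x_def)
    assume "\<not> 1 / 2 < 1 / (1 - s) - 1 / (t - 1)"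
    then have "1 / (1 - s) \<le> (2 + x) / (2 * x)"
      using x by (simp add: field_simps flip: x_def)
    then have "s \<le> (2 - x) / (2 + x)"
      using assms x by (simp add: field_simps)
    moreover from this have "x < 2"
      using assms x by (smt (verit) divide_nonpos_pos)
    ultimately have "(2 - x) / (2 + x) - ln ((2 - x) / (2 + x)) \<le> s - ln s"
      using id_minus_ln_less(1)[of s "(2 - x) / (2 + x)"] assms x by fastforce
    then show False
      using id_minus_ln_moebius_greater[OF x \<open>x < 2\<close>] eq by (simp add: x_def)
  qed
qed

section \<open>Straightening coordinates\<close>

locale oscillator =
  fixes a :: real
  assumes a_pos: "0 < a"
begin

definition pot :: "real \<Rightarrow> real" where
  "pot u = exp (- a * u) - 1 + a * u"

text \<open>Chosen so that \<open>1 + (coord u)\<^sup>2 = exp (2 * pot u / a)\<close>: conservation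
  of the first integral then says that \<open>1 + C\<^sup>2 + D\<^sup>2\<close> is constant, which
  is why orbits are circles.\<close>

definition coord :: "real \<Rightarrow> real" where
  "coord u = sgn u * sqrt (exp (2 * pot u / a) - 1)"

text \<open>The general formula is \<open>0 / 0\<close> at \<open>u = 0\<close>; there the slope is \<open>sqrt a\<close>.\<close>

definition dcoord :: "real \<Rightarrow> real" where
  "dcoord u = (if u = 0 then sqrt a else exp (2 * pot u / a) * (1 - exp (- a * u)) / coord u)"

lemma pot_pos: "u \<noteq> 0 \<Longrightarrow> 0 < pot u"
  using exp_minus_greater[of "a * u"] a_pos by (simp add: pot_def)

lemma pot_nonneg: "0 \<le> pot u"
  using exp_ge_add_one_self[of "- a * u"] by (simp add: pot_def)

lemma pot_has_real_derivative: "(pot has_real_derivative a * (1 - exp (- a * u))) (at u)"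
  unfolding pot_def by (auto intro!: derivative_eq_intros simp: algebra_simps)

lemma isCont_pot: "isCont pot u"
  using DERIV_isCont pot_has_real_derivative by blast

lemma coord_0 [simp]: "coord 0 = 0"
  by (simp add: coord_def)

lemma coord_square: "(coord u)\<^sup>2 = exp (2 * pot u / a) - 1"
proof -
  have "(sgn u)\<^sup>2 * (exp (2 * pot u / a) - 1) = exp (2 * pot u / a) - 1"
    by (cases "u = 0") (auto simp: pot_def power2_eq_square sgn_real_def)
  then show ?thesis
    using pot_nonneg[of u] a_pos by (simp add: coord_def power_mult_distrib)
qed

lemma coord_pos: "0 < u \<Longrightarrow> 0 < coord u"
  using pot_pos[of u] a_pos by (simp add: coord_def)

lemma coord_neg: "u < 0 \<Longrightarrow> coord u < 0"
  using pot_pos[of u] a_pos by (simp add: coord_def mult_neg_pos)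

lemma coord_nonzero: "u \<noteq> 0 \<Longrightarrow> coord u \<noteq> 0"
  using coord_pos[of u] coord_neg[of u] by fastforce

lemma dcoord_pos: "0 < dcoord u"
proof (cases u "0 :: real" rule: linorder_cases)
  case less
  then show ?thesis
    using coord_neg[OF less] a_pos
    by (auto simp: dcoord_def intro!: divide_neg_neg mult_pos_neg mult_pos_neg)
next
  case greater
  then show ?thesis
    using coord_pos[OF greater] a_pos by (simp add: dcoord_def)
qed (simp add: dcoord_def a_pos)

text \<open>Near 0, \<open>pot u\<close> is \<open>(a * u)\<^sup>2 / 2\<close> to leading order, so
  \<open>exp (2 * pot u / a) - 1\<close> behaves like \<open>a * u\<^sup>2\<close>.\<close>

lemma coord_over_id_tendsto: "((\<lambda>u. coord u / u) \<longlongrightarrow> sqrt a) (at 0)"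
proof -
  have "((\<lambda>u. (exp (2 * (exp (- a * u) - 1 + a * u) / a) - 1) / u\<^sup>2) \<longlongrightarrow> a) (at 0)"
    using a_pos by real_asymp
  then have "((\<lambda>u. sqrt ((exp (2 * pot u / a) - 1) / u\<^sup>2)) \<longlongrightarrow> sqrt a) (at 0)"
    unfolding pot_def by (rule tendsto_real_sqrt)
  moreover have "\<forall>\<^sub>F u in at 0. sqrt ((exp (2 * pot u / a) - 1) / u\<^sup>2) = coord u / u"
    unfolding eventually_at_filter
    by (auto simp: coord_def real_sqrt_divide sgn_real_def)
  ultimately show ?thesis
    by (rule Lim_transform_eventually)
qed

lemma coord_has_real_derivative: "(coord has_real_derivative dcoord u) (at u)"
proof (cases "u = 0")
  case True
  then show ?thesis
    using coord_over_id_tendsto by (simp add: has_field_derivative_iff dcoord_def)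
next
  case False
  \<comment> \<open>On this open half-line around \<open>u\<close> the sign is constant, so
    \<open>coord\<close> is a fixed multiple of the square root there.\<close>
  define S where "S = {w. 0 < sgn u * w}"
  have S: "open S" "u \<in> S"
    unfolding S_def using False
    by (auto intro!: open_Collect_less continuous_intros simp: sgn_real_def)
  have sgn_S: "sgn w = sgn u" if "w \<in> S" for w
    using that by (auto simp: S_def sgn_real_def zero_less_mult_iff split: if_splits)
  define E where "E = exp (2 * pot u / a)"
  have E: "1 < E"
    using pot_pos[OF False] a_pos by (simp add: E_def)
  have d: "((\<lambda>w. exp (2 * pot w / a) - 1) has_real_derivative E * (2 * (1 - exp (- a * u)))) (at u)"
    using a_pos by (auto intro!: derivative_eq_intros pot_has_real_derivative simp: E_def)
  have "((\<lambda>w. sqrt (exp (2 * pot w / a) - 1)) has_real_derivative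
      inverse (sqrt (E - 1)) / 2 * (E * (2 * (1 - exp (- a * u))))) (at u)"
    using DERIV_chain2[OF DERIV_real_sqrt d] E by (simp add: E_def)
  then have "((\<lambda>w. sgn u * sqrt (exp (2 * pot w / a) - 1)) has_real_derivative
      sgn u * (inverse (sqrt (E - 1)) / 2 * (E * (2 * (1 - exp (- a * u)))))) (at u)"
    by (rule DERIV_cmult)
  moreover have "sgn u * (inverse (sqrt (E - 1)) / 2 * (E * (2 * (1 - exp (- a * u))))) = dcoord u"
    using False by (simp add: dcoord_def coord_def flip: E_def) (simp add: sgn_real_def divide_inverse)
  ultimately have "((\<lambda>w. sgn u * sqrt (exp (2 * pot w / a) - 1)) has_real_derivative dcoord u) (at u)"
    by simp
  then show ?thesis
    by (rule has_field_derivative_transform_within_open[OF _ S]) (simp add: coord_def sgn_S)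
qed

lemma isCont_dcoord: "isCont dcoord u"
proof (cases "u = 0")
  case True
  \<comment> \<open>Dividing numerator and denominator by \<open>u\<close> resolves the
    \<open>0 / 0\<close>; the limit is \<open>a / sqrt a\<close>.\<close>
  have "((\<lambda>u. (1 - exp (- a * u)) / u) \<longlongrightarrow> a) (at 0)"
    using a_pos by real_asymp
  moreover have "((\<lambda>u. exp (2 * pot u / a)) \<longlongrightarrow> exp (2 * pot 0 / a)) (at 0)"
    using a_pos isCont_pot[of 0] by (intro tendsto_intros) (auto simp: isCont_def)
  ultimately have "((\<lambda>u. exp (2 * pot u / a) * ((1 - exp (- a * u)) / u) / (coord u / u))
      \<longlongrightarrow> exp (2 * pot 0 / a) * a / sqrt a) (at 0)"
    using a_pos by (intro tendsto_mult tendsto_divide coord_over_id_tendsto) auto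
  moreover have "\<forall>\<^sub>F u in at 0.
      exp (2 * pot u / a) * ((1 - exp (- a * u)) / u) / (coord u / u) = dcoord u"
    by (auto simp: eventually_at_filter dcoord_def)
  ultimately have "(dcoord \<longlongrightarrow> exp (2 * pot 0 / a) * a / sqrt a) (at 0)"
    by (rule Lim_transform_eventually)
  moreover have "exp (2 * pot 0 / a) * a / sqrt a = dcoord 0"
    using a_pos by (simp add: pot_def dcoord_def real_div_sqrt)
  ultimately show ?thesis
    using True by (simp add: isCont_def)
next
  case False
  have "\<forall>\<^sub>F w in nhds u. w \<noteq> 0"
    using False by (rule t1_space_nhds)
  then have ev: "\<forall>\<^sub>F w in nhds u. exp (2 * pot w / a) * (1 - exp (- a * w)) / coord w = dcoord w"
    by eventually_elim (simp add: dcoord_def)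
  have "isCont (\<lambda>w. exp (2 * pot w / a) * (1 - exp (- a * w)) / coord w) u"
    using a_pos coord_nonzero[OF False] isCont_pot DERIV_isCont[OF coord_has_real_derivative]
    by (intro continuous_intros) auto
  then show ?thesis
    using isCont_cong[OF ev] by simp
qed

lemma surj_coord: "surj coord"
proof -
  have cont: "continuous_on A coord" for A
    by (meson DERIV_isCont coord_has_real_derivative continuous_at_imp_continuous_on)
  have sq: "2 * pot u / a \<le> (coord u)\<^sup>2" for u
    unfolding coord_square using exp_ge_add_one_self[of "2 * pot u / a"] by linarith
  have "\<exists>u. coord u = y" for y
  proof -
    define M where "M = \<bar>y\<bar>"
    \<comment> \<open>To the right linear growth suffices:
      \<open>pot p \<ge> a * p - 1 = a * M\<^sup>2\<close>.\<close>
    define p where "p = M\<^sup>2 + 1 / a"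
    have p: "0 < p" using a_pos by (simp add: p_def add_nonneg_pos)
    have "2 * M\<^sup>2 \<le> 2 * pot p / a"
      using a_pos by (simp add: pot_def p_def field_simps)
    then have "M\<^sup>2 \<le> (coord p)\<^sup>2"
      using sq[of p] zero_le_power2[of M] by linarith
    then have upper: "M \<le> coord p"
      using coord_pos[OF p] by (metis less_imp_le power2_le_imp_le)
    \<comment> \<open>To the left the quadratic Taylor bound gives
      \<open>2 * pot (- q) / a \<ge> a * q\<^sup>2\<close>, which equals
      \<open>(M + 1)\<^sup>2\<close> for this \<open>q\<close>.\<close>
    define q where "q = (M + 1) / sqrt a"
    have q: "0 < q" using a_pos by (simp add: q_def M_def)
    have "(a * q)\<^sup>2 / 2 \<le> pot (- q)"
      using exp_lower_Taylor_quadratic[of "a * q"] a_pos q by (simp add: pot_def)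
    then have "2 * ((a * q)\<^sup>2 / 2) / a \<le> 2 * pot (- q) / a"
      using a_pos by (intro divide_right_mono) auto
    moreover have "2 * ((a * q)\<^sup>2 / 2) / a = (M + 1)\<^sup>2"
      using a_pos by (simp add: q_def power2_eq_square field_simps)
    ultimately have "(M + 1)\<^sup>2 \<le> (- coord (- q))\<^sup>2"
      using sq[of "- q"] by simp
    then have lower: "M + 1 \<le> - coord (- q)"
      by (rule power2_le_imp_le) (use coord_neg[of "- q"] q in simp)
    have "coord (- q) \<le> y" "y \<le> coord p" "- q \<le> p"
      using upper lower p q by (simp_all add: M_def abs_if split: if_splits)
    then have "\<exists>u. - q \<le> u \<and> u \<le> p \<and> coord u = y"
      by (rule IVT'[OF _ _ _ cont])
    then show ?thesis by blast
  qed
  then show ?thesis by (metis surjI)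
qed

section \<open>The inverse coordinate and the density of time\<close>

definition height :: "real \<Rightarrow> real" where
  "height = inv coord"

lemma strict_mono_coord: "strict_mono coord"
  by (rule inv_has_real_derivative(1)[OF coord_has_real_derivative dcoord_pos surj_coord])

lemma coord_height [simp]: "coord (height x) = x"
  by (simp add: height_def surj_coord surj_f_inv_f)

lemma height_coord [simp]: "height (coord u) = u"
  by (simp add: height_def strict_mono_coord strict_mono_imp_inj_on)

lemma strict_mono_height: "strict_mono height"
  by (rule strict_monoI) (metis coord_height strict_mono_coord strict_mono_less)

lemma height_0 [simp]: "height 0 = 0"
  using height_coord[of 0] by simp

lemma height_pos: "0 < x \<Longrightarrow> 0 < height x"
  using strict_mono_less[OF strict_mono_height, of 0 x] by simp

lemma height_neg: "x < 0 \<Longrightarrow> height x < 0"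
  using strict_mono_less[OF strict_mono_height, of x 0] by simp

lemma height_has_real_derivative:
  "(height has_real_derivative inverse (dcoord (height x))) (at x)"
  unfolding height_def
  by (rule inv_has_real_derivative(2)[OF coord_has_real_derivative dcoord_pos surj_coord])

lemma isCont_height: "isCont height x"
  using DERIV_isCont height_has_real_derivative by blast

lemma exp_pot_height: "exp (2 * pot (height x) / a) = 1 + x\<^sup>2"
  using coord_square[of "height x"] by simp

lemma pot_height_minus: "pot (height (- x)) = pot (height x)"
proof -
  have "exp (2 * pot (height (- x)) / a) = exp (2 * pot (height x) / a)"
    unfolding exp_pot_height by simp
  then show ?thesis using a_pos by simp
qed

lemma dcoord_height:
  "x \<noteq> 0 \<Longrightarrow> dcoord (height x) = (1 + x\<^sup>2) * (1 - exp (- a * height x)) / x"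
  using height_pos[of x] height_neg[of x] exp_pot_height[of x]
  by (cases "0 < x") (auto simp: dcoord_def)

text \<open>Reciprocal of the angular speed: the time spent per unit of angle at coordinate
  \<open>x\<close>.\<close>

definition density :: "real \<Rightarrow> real" where
  "density x = sqrt (1 + x\<^sup>2) / dcoord (height x)"

definition pair_density :: "real \<Rightarrow> real" where
  "pair_density x = density x + density (- x)"

lemma density_pos: "0 < density x"
  by (simp add: density_def dcoord_pos add_pos_nonneg)

lemma isCont_density: "isCont density x"
  unfolding density_def
proof (rule isCont_divide)
  show "isCont (\<lambda>x. sqrt (1 + x\<^sup>2)) x"
    by (intro continuous_intros)
  show "isCont (\<lambda>x. dcoord (height x)) x"
    by (rule isCont_o2[OF isCont_height isCont_dcoord])
  show "dcoord (height x) \<noteq> 0"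
    using dcoord_pos[of "height x"] by simp
qed

lemma isCont_pair_density: "isCont pair_density x"
  unfolding pair_density_def
  using isCont_o2[where f = uminus and g = density, OF _ isCont_density, of x]
  by (intro isCont_add isCont_density) simp

lemma pair_density_minus: "pair_density (- x) = pair_density x"
  by (simp add: pair_density_def)

lemma pair_density_0: "pair_density 0 = 2 / sqrt a"
  by (simp add: pair_density_def density_def dcoord_def)

lemma density_nonzero:
  assumes "x \<noteq> 0"
  shows "density x = x / sqrt (1 + x\<^sup>2) * (1 / (1 - exp (- a * height x)))"
proof -
  have "density x = sqrt (1 + x\<^sup>2) / (1 + x\<^sup>2) * x / (1 - exp (- a * height x))"
    by (simp add: density_def dcoord_height[OF assms])
  also have "sqrt (1 + x\<^sup>2) / (1 + x\<^sup>2) = 1 / sqrt (1 + x\<^sup>2)"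
    using sqrt_one_plus_square_pos[of x] by (simp add: field_simps flip: power2_eq_square)
  finally show ?thesis by simp
qed

section \<open>The density as a function of the amplitude\<close>

text \<open>The larger root \<open>t\<close> belongs to the point with coordinate
  \<open>- x\<close>; the smaller root \<open>s\<close>, used in \<open>beta\<close>, to the point
  with coordinate \<open>x\<close>.\<close>

definition alpha :: "real \<Rightarrow> real" where
  "alpha x = 1 / (exp (- a * height (- x)) - 1)"

definition beta :: "real \<Rightarrow> real" where
  "beta x = 1 / (1 - exp (- a * height x))"

lemma pair_density_eq:
  assumes "0 < x"
  shows "pair_density x = x / sqrt (1 + x\<^sup>2) * (alpha x + beta x)"
proof -
  have "density (- x) = x / sqrt (1 + x\<^sup>2) * alpha x"
  proof -
    have "1 / (1 - exp (- a * height (- x))) = - alpha x"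
      unfolding alpha_def by (metis minus_diff_eq minus_divide_right)
    then show ?thesis
      using assms density_nonzero[of "- x"] by simp
  qed
  moreover have "density x = x / sqrt (1 + x\<^sup>2) * beta x"
    using assms density_nonzero[of x] by (simp add: beta_def)
  ultimately show ?thesis
    by (simp add: pair_density_def distrib_left)
qed

text \<open>The points with coordinates \<open>x\<close> and \<open>- x\<close> lie on the same
  level of \<open>pot\<close>, so their exponentials are the two roots treated in
  \<open>id_minus_ln_roots\<close>.\<close>

lemma alpha_beta_bounds:
  assumes "0 < x"
  shows "0 < alpha x" "1 < beta x" "1 / 2 < beta x - alpha x" "beta x - alpha x < 1"
proof -
  define s where "s = exp (- (a * height x))"
  define t where "t = exp (- (a * height (- x)))"
  have st: "0 < s" "s < 1" "1 < t"
    using height_pos[OF assms] mult_pos_neg[OF a_pos height_neg[of "- x"]] a_pos assms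
    by (simp_all add: s_def t_def)
  have eq: "s - ln s = t - ln t"
    using pot_height_minus[of x] by (simp add: s_def t_def pot_def)
  show "0 < alpha x" using st by (simp add: alpha_def flip: t_def)
  show "1 < beta x" using st by (simp add: beta_def flip: s_def)
  show "1 / 2 < beta x - alpha x" "beta x - alpha x < 1"
    using id_minus_ln_roots[OF st eq] by (simp_all add: alpha_def beta_def flip: s_def t_def)
qed

text \<open>\<open>rate\<close> is the derivative of \<open>m = a * ln (1 + x\<^sup>2) / 2\<close>, so that derivatives with respect to
  \<open>m\<close> are those with respect to \<open>x\<close> divided by \<open>rate x\<close>.\<close>

definition rate :: "real \<Rightarrow> real" where
  "rate x = a * x / (1 + x\<^sup>2)"

lemma rate_pos: "0 < x \<Longrightarrow> 0 < rate x"
  using a_pos by (simp add: rate_def add_pos_nonneg)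

text \<open>From \<open>m = t - 1 - ln t\<close> one gets \<open>dt/dm = t / (t - 1)\<close>;
  substituting \<open>t = 1 + 1 / alpha x\<close> makes the derivative in \<open>m\<close> a
  polynomial in \<open>alpha\<close>. The same works for \<open>beta\<close> with
  \<open>s = 1 - 1 / beta x\<close>.\<close>

lemma alpha_has_real_derivative:
  assumes "0 < x"
  shows "(alpha has_real_derivative - rate x * (alpha x ^ 3 + (alpha x)\<^sup>2)) (at x)"
proof -
  define t where "t = exp (- (a * height (- x)))"
  have t: "1 < t"
    using mult_pos_neg[OF a_pos height_neg[of "- x"]] assms by (simp add: t_def)
  have t_alpha: "t = 1 + 1 / alpha x"
    using t by (simp add: alpha_def flip: t_def)
  have "((\<lambda>x. height (- x)) has_real_derivative inverse (dcoord (height (- x))) * - 1) (at x)"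
    by (rule DERIV_chain2[OF height_has_real_derivative]) (auto intro!: derivative_eq_intros)
  moreover have "dcoord (height (- x)) = (1 + x\<^sup>2) * (t - 1) / x"
    using dcoord_height[of "- x"] assms by (simp add: algebra_simps minus_divide_left flip: t_def)
  ultimately have d: "((\<lambda>x. height (- x)) has_real_derivative - (x / ((1 + x\<^sup>2) * (t - 1)))) (at x)"
    by simp
  have "(alpha has_real_derivative - (t * (- a * - (x / ((1 + x\<^sup>2) * (t - 1))))) / (t - 1)\<^sup>2) (at x)"
    unfolding alpha_def using t
    by (auto intro!: derivative_eq_intros d simp: power2_eq_square) (simp_all add: t_def)
  also have "- (t * (- a * - (x / ((1 + x\<^sup>2) * (t - 1))))) / (t - 1)\<^sup>2
      = - rate x * (t * (1 / (t - 1)) ^ 3)"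
    by (simp add: rate_def power3_eq_cube power2_eq_square ac_simps)
  also have "t * (1 / (t - 1)) ^ 3 = t * alpha x ^ 3"
    by (simp add: alpha_def flip: t_def)
  also have "\<dots> = alpha x ^ 3 + (alpha x)\<^sup>2"
    using alpha_beta_bounds(1)[OF assms] by (simp add: t_alpha field_simps power2_eq_square power3_eq_cube)
  finally show ?thesis .
qed

lemma beta_has_real_derivative:
  assumes "0 < x"
  shows "(beta has_real_derivative - rate x * (beta x ^ 3 - (beta x)\<^sup>2)) (at x)"
proof -
  define s where "s = exp (- (a * height x))"
  have s: "s < 1"
    using height_pos[OF assms] a_pos by (simp add: s_def)
  have s_beta: "s = 1 - 1 / beta x"
    using s by (simp add: beta_def flip: s_def)
  have d: "(height has_real_derivative x / ((1 + x\<^sup>2) * (1 - s))) (at x)"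
    using height_has_real_derivative[of x] dcoord_height[of x] assms by (simp flip: s_def)
  have "(beta has_real_derivative (s * (- a * (x / ((1 + x\<^sup>2) * (1 - s))))) / (1 - s)\<^sup>2) (at x)"
    unfolding beta_def using s
    by (auto intro!: derivative_eq_intros d simp: power2_eq_square) (simp_all add: s_def)
  also have "(s * (- a * (x / ((1 + x\<^sup>2) * (1 - s))))) / (1 - s)\<^sup>2
      = - rate x * (s * (1 / (1 - s)) ^ 3)"
    by (simp add: rate_def power3_eq_cube power2_eq_square ac_simps)
  also have "s * (1 / (1 - s)) ^ 3 = s * beta x ^ 3"
    by (simp add: beta_def flip: s_def)
  also have "\<dots> = beta x ^ 3 - (beta x)\<^sup>2"
    using alpha_beta_bounds(2)[OF assms] by (simp add: s_beta field_simps power2_eq_square power3_eq_cube)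
  finally show ?thesis .
qed

text \<open>\<open>quot\<close> is the \<open>V\<close> of the introduction; \<open>quot1\<close> and \<open>quot2\<close> are its first and second derivatives
  with respect to \<open>m\<close>, and \<open>lograte\<close>, with derivative \<open>lograte'\<close>, is the derivative of \<open>ln V\<close>.\<close>

definition quot :: "real \<Rightarrow> real" where
  "quot x = 1 / (alpha x + beta x)\<^sup>2"

definition lograte :: "real \<Rightarrow> real" where
  "lograte x = 2 * ((alpha x)\<^sup>2 - alpha x * beta x + (beta x)\<^sup>2 + alpha x - beta x)"

definition quot1 :: "real \<Rightarrow> real" where
  "quot1 x = lograte x * quot x"

text \<open>In terms of sum and difference, multiplication by \<open>quot\<close> turns the square
  of the sum into 1.\<close>

lemma lograte_eq:
  "lograte x = (3 * (beta x - alpha x)\<^sup>2 - 4 * (beta x - alpha x) + (alpha x + beta x)\<^sup>2) / 2"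
  by (simp add: lograte_def power2_eq_square algebra_simps)

lemma alpha_plus_beta_gt_1: "0 < x \<Longrightarrow> 1 < alpha x + beta x"
  using alpha_beta_bounds[of x] by linarith

lemma quot_pos: "0 < x \<Longrightarrow> 0 < quot x"
  using alpha_plus_beta_gt_1[of x] by (simp add: quot_def)

lemma lograte_pos:
  assumes "0 < x"
  shows "0 < lograte x"
proof -
  define A d where "A = alpha x" and "d = beta x - alpha x"
  have b: "beta x = A + d" by (simp add: A_def d_def)
  have bounds: "0 < A" "1 < A + d" "1 / 2 < d" "d < 1"
    using alpha_beta_bounds[OF assms] by (simp_all add: A_def d_def)
  \<comment> \<open>In \<open>A\<close> and \<open>d\<close>, half of \<open>lograte x\<close> is
    \<open>A * (A + d) - d * (1 - d)\<close>.\<close>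
  have "d * (1 - d) \<le> 1 - d"
    using bounds by (intro mult_left_le_one_le) auto
  also have "1 - d < A"
    using bounds by linarith
  also have "A < A * (A + d)"
    using bounds by simp
  finally have "0 < A * (A + d) - d * (1 - d)"
    by simp
  then show ?thesis
    by (simp add: lograte_def b A_def[symmetric] power2_eq_square algebra_simps)
qed

lemma quot1_pos: "0 < x \<Longrightarrow> 0 < quot1 x"
  by (simp add: quot1_def lograte_pos quot_pos)

text \<open>By \<open>lograte_eq\<close>, \<open>2 * quot1 x\<close> is
  \<open>1 + (3 * d\<^sup>2 - 4 * d) * quot x\<close>, and for \<open>d\<close> between 1/2 and 1
  the quadratic lies between -4 and -1. The upper bound drives the case \<open>a \<le> 4\<close>;
  the lower one fixes the limit at 0.\<close>

lemma quot1_bounds: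
  assumes "0 < x"
  shows "1 / 2 - 2 * quot x \<le> quot1 x" and "2 * quot1 x < 1 - quot x"
proof -
  define d where "d = beta x - alpha x"
  have d: "1 / 2 < d" "d < 1"
    using alpha_beta_bounds[OF assms] by (simp_all add: d_def)
  have "(alpha x + beta x)\<^sup>2 * quot x = 1"
    using alpha_plus_beta_gt_1[OF assms] by (simp add: quot_def)
  moreover define Y where "Y = (3 * d\<^sup>2 - 4 * d) * quot x"
  ultimately have eq: "2 * quot1 x = Y + 1"
    unfolding quot1_def lograte_eq d_def[symmetric] by (simp add: algebra_simps)
  have "(3 * d - 1) * (d - 1) < 0"
    using d by (intro mult_pos_neg) auto
  then have "3 * d\<^sup>2 - 4 * d < - 1"
    by (simp add: power2_eq_square algebra_simps)
  moreover have "- 4 \<le> 3 * d\<^sup>2 - 4 * d"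
    using d zero_le_power2[of d] by linarith
  ultimately have "- 4 * quot x \<le> Y" "Y < - 1 * quot x"
    unfolding Y_def using quot_pos[OF assms]
    by (intro mult_right_mono mult_strict_right_mono; simp)+
  then show "1 / 2 - 2 * quot x \<le> quot1 x" "2 * quot1 x < 1 - quot x"
    using eq by linarith+
qed

definition lograte' :: "real \<Rightarrow> real" where
  "lograte' x = (let A = alpha x; B = beta x; A' = - (A ^ 3 + A\<^sup>2); B' = - (B ^ 3 - B\<^sup>2)
    in 2 * (2 * A * A' - (A' * B + A * B') + 2 * B * B' + A' - B'))"

definition quot2 :: "real \<Rightarrow> real" where
  "quot2 x = (lograte' x + (lograte x)\<^sup>2) * quot x"

lemma quot_has_real_derivative:
  assumes "0 < x"
  shows "(quot has_real_derivative rate x * quot1 x) (at x)"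
proof -
  define A B k where "A = alpha x" and "B = beta x" and "k = rate x"
  define S where "S = A + B"
  have S: "S \<noteq> 0"
    using alpha_plus_beta_gt_1[OF assms] by (simp add: A_def B_def S_def)
  have "((\<lambda>x. alpha x + beta x) has_real_derivative - k * (A ^ 3 + A\<^sup>2) + - k * (B ^ 3 - B\<^sup>2)) (at x)"
    unfolding A_def B_def k_def
    by (intro DERIV_add alpha_has_real_derivative beta_has_real_derivative assms)
  \<comment> \<open>The sum \<open>A ^ 3 + B ^ 3 + A\<^sup>2 - B\<^sup>2\<close> is divisible by
    \<open>A + B\<close>, and the cofactor is half of \<open>lograte x\<close>.\<close>
  moreover have "- k * (A ^ 3 + A\<^sup>2) + - k * (B ^ 3 - B\<^sup>2) = - k * (S * (lograte x / 2))"
    unfolding lograte_def A_def[symmetric] B_def[symmetric] S_def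
    by (simp add: power2_eq_square power3_eq_cube algebra_simps)
  ultimately have d: "((\<lambda>x. alpha x + beta x) has_real_derivative - k * (S * (lograte x / 2))) (at x)"
    by simp
  have eq: "alpha x + beta x = S"
    by (simp add: S_def A_def B_def)
  have sq: "((\<lambda>x. (alpha x + beta x)\<^sup>2) has_real_derivative
      2 * S * (- k * (S * (lograte x / 2)))) (at x)"
    by (rule DERIV_cong[OF DERIV_power[OF d]]) (simp add: eq)
  have "((\<lambda>x. inverse ((alpha x + beta x)\<^sup>2)) has_real_derivative
      - (inverse (S\<^sup>2) * (2 * S * (- k * (S * (lograte x / 2)))) * inverse (S\<^sup>2))) (at x)"
    by (rule DERIV_cong[OF DERIV_inverse'[OF sq]]) (simp_all add: eq S)
  moreover have "- (inverse (S\<^sup>2) * (2 * S * (- k * (S * (lograte x / 2)))) * inverse (S\<^sup>2))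
      = k * (lograte x * inverse (S\<^sup>2))"
    using S by (simp add: power2_eq_square field_simps)
  ultimately show ?thesis
    by (simp add: quot_def[abs_def] quot1_def inverse_eq_divide eq k_def)
qed

lemma lograte_has_real_derivative:
  assumes "0 < x"
  shows "(lograte has_real_derivative rate x * lograte' x) (at x)"
proof -
  have *: "((\<lambda>x. 2 * ((f x)\<^sup>2 - f x * g x + (g x)\<^sup>2 + f x - g x)) has_real_derivative
      2 * (2 * f x * D - (D * g x + f x * D') + 2 * g x * D' + D - D')) (at x)"
    if "(f has_real_derivative D) (at x)" "(g has_real_derivative D') (at x)"
    for f g :: "real \<Rightarrow> real" and D D'
    using that by (auto intro!: derivative_eq_intros)
  show ?thesis
    unfolding lograte_def[abs_def]
    by (rule DERIV_cong[OF *[OF alpha_has_real_derivative beta_has_real_derivative, OF assms assms]])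
      (simp add: lograte'_def Let_def algebra_simps)
qed

lemma quot1_has_real_derivative:
  assumes "0 < x"
  shows "(quot1 has_real_derivative rate x * quot2 x) (at x)"
proof -
  have "(quot1 has_real_derivative
      (rate x * lograte' x) * quot x + (rate x * quot1 x) * lograte x) (at x)"
    unfolding quot1_def[abs_def] using DERIV_mult[OF lograte_has_real_derivative quot_has_real_derivative, OF assms assms]
    by (simp add: quot1_def)
  then show ?thesis
    by (simp add: quot1_def quot2_def power2_eq_square algebra_simps)
qed

text \<open>After division by \<open>quot x\<close> the claim is a polynomial in \<open>d\<close>
  and \<open>X\<close>, affine in \<open>X\<close>. Inserting the lower bound
  \<open>(2 - d)\<^sup>2\<close> for \<open>X\<close> leaves the square
  \<open>8 * (1 - d)\<^sup>2\<close>.\<close>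

lemma quot2_bound:
  assumes "0 < x"
  shows "0 < quot2 x + 2 * quot1 x"
proof -
  define A d where "A = alpha x" and "d = beta x - alpha x"
  have b: "beta x = A + d" by (simp add: A_def d_def)
  have bounds: "0 < A" "1 < A + d" "1 / 2 < d" "d < 1"
    using alpha_beta_bounds[OF assms] by (simp_all add: A_def d_def)
  define X where "X = (2 * A + d)\<^sup>2"
  \<comment> \<open>\<open>2 * A + d = \<alpha> + \<beta>\<close>, and \<open>\<beta> > 1\<close> turns into \<open>\<alpha> + \<beta> > 2 - d\<close>.\<close>
  have "(2 - d)\<^sup>2 < X"
    unfolding X_def using bounds by (intro power_strict_mono) auto
  then have "(4 - 3 * d) * (2 - d)\<^sup>2 < (4 - 3 * d) * X"
    using bounds by (intro mult_strict_left_mono) auto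
  moreover have "(4 - 3 * d) * (2 - d)\<^sup>2 = 8 - 12 * d + 8 * d\<^sup>2 - 3 * d ^ 3 + 8 * (1 - d)\<^sup>2"
    by (simp add: power2_eq_square power3_eq_cube algebra_simps)
  ultimately have "0 < (4 - 3 * d) * X - (8 - 12 * d + 8 * d\<^sup>2 - 3 * d ^ 3)"
    using zero_le_power2[of "1 - d"] by linarith
  then have "0 < d / 2 * ((4 - 3 * d) * X - (8 - 12 * d + 8 * d\<^sup>2 - 3 * d ^ 3))"
    using bounds by (intro mult_pos_pos) auto
  also have "\<dots> = lograte' x + (lograte x)\<^sup>2 + 2 * lograte x"
    unfolding lograte'_def lograte_def Let_def b A_def[symmetric] X_def
    by (simp add: power2_eq_square power3_eq_cube algebra_simps)
  finally have "0 < (lograte' x + (lograte x)\<^sup>2 + 2 * lograte x) * quot x"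
    using quot_pos[OF assms] by simp
  then show ?thesis
    by (simp add: quot1_def quot2_def algebra_simps)
qed

section \<open>Limits at small amplitude\<close>

lemma quot_tendsto_0: "(quot \<longlongrightarrow> 0) (at_right 0)"
proof (rule tendsto_sandwich)
  show "\<forall>\<^sub>F x in at_right 0. 0 \<le> quot x"
    by (rule always_eventually) (simp add: quot_def)
  have "isCont (\<lambda>x. (exp (- a * height (- x)) - 1)\<^sup>2) 0"
    using isCont_o2[where f = uminus and g = height, OF _ isCont_height, of 0]
    by (intro continuous_intros) auto
  then show "((\<lambda>x. (exp (- a * height (- x)) - 1)\<^sup>2) \<longlongrightarrow> 0) (at_right 0)"
    by (auto simp: isCont_def intro: filterlim_at_split[THEN iffD1, THEN conjunct2])
  show "\<forall>\<^sub>F x in at_right 0. quot x \<le> (exp (- a * height (- x)) - 1)\<^sup>2"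
    using eventually_at_right_less
  proof eventually_elim
    case (elim x)
    have "quot x \<le> 1 / (alpha x)\<^sup>2"
      unfolding quot_def using alpha_beta_bounds[OF elim]
      by (intro divide_left_mono power_mono mult_pos_pos zero_less_power) auto
    also have "1 / (alpha x)\<^sup>2 = (exp (- a * height (- x)) - 1)\<^sup>2"
      by (simp add: alpha_def power_divide)
    finally show ?case .
  qed
qed simp

lemma quot1_tendsto: "(quot1 \<longlongrightarrow> 1 / 2) (at_right 0)"
proof (rule tendsto_sandwich)
  show "((\<lambda>x. 1 / 2 - 2 * quot x) \<longlongrightarrow> 1 / 2) (at_right 0)"
    using tendsto_diff[OF tendsto_const tendsto_mult[OF tendsto_const quot_tendsto_0], of "1 / 2" 2] by simp
  show "\<forall>\<^sub>F x in at_right 0. 1 / 2 - 2 * quot x \<le> quot1 x"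
    using eventually_at_right_less by eventually_elim (rule quot1_bounds)
  show "\<forall>\<^sub>F x in at_right 0. quot1 x \<le> 1 / 2"
    using eventually_at_right_less
  proof eventually_elim
    case (elim x)
    then show ?case using quot1_bounds(2)[OF elim] quot_pos[OF elim] by linarith
  qed
qed simp

lemma pair_density_square:
  assumes "0 < x"
  shows "(pair_density x)\<^sup>2 = 1 / (quot x * (1 + 1 / x\<^sup>2))"
proof -
  have "(pair_density x)\<^sup>2 = x\<^sup>2 / (1 + x\<^sup>2) * (alpha x + beta x)\<^sup>2"
    using assms by (simp add: pair_density_eq power_mult_distrib power_divide)
  moreover have "1 + 1 / x\<^sup>2 = (1 + x\<^sup>2) / x\<^sup>2"
    using assms by (simp add: field_simps)
  ultimately show ?thesis
    by (simp add: quot_def)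
qed

section \<open>Bounds and monotonicity of the pair density\<close>

lemma pair_density_pos: "0 < pair_density x"
  by (simp add: pair_density_def density_pos add_pos_pos)

text \<open>For \<open>x > 0\<close> the claim is equivalent to
  \<open>(1 - quot x) * (1 + x\<^sup>2) > 1\<close>. The left side starts at 1, and its derivative
  has the sign of \<open>2 * (1 - quot x) - a * quot1 x\<close>, which \<open>quot1_bounds\<close>
  makes positive up to \<open>a = 4\<close>.\<close>

lemma pair_density_gt_1:
  assumes "a \<le> 4" "x \<noteq> 0"
  shows "1 < pair_density x"
proof -
  have *: "1 < pair_density x" if x: "0 < x" for x
  proof -
    have "1 < (1 - quot x) * (1 + x\<^sup>2)"
    proof (rule gt_limit_at_right_0[OF _ _ _ x])
      fix y :: real assume y: "0 < y"
      have pos: "1 + y\<^sup>2 \<noteq> 0" using one_plus_square_pos[of y] by simp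
      have "((\<lambda>x. (1 - quot x) * (1 + x\<^sup>2)) has_real_derivative
          - (rate y * quot1 y) * (1 + y\<^sup>2) + (1 - quot y) * (2 * y)) (at y)"
        using quot_has_real_derivative[OF y] by (auto intro!: derivative_eq_intros)
      moreover have "rate y * (1 + y\<^sup>2) = a * y"
        using pos by (simp add: rate_def)
      then have "(rate y * quot1 y) * (1 + y\<^sup>2) = a * y * quot1 y"
        by (metis mult.assoc mult.commute)
      then have "- (rate y * quot1 y) * (1 + y\<^sup>2) + (1 - quot y) * (2 * y)
          = y * (2 * (1 - quot y) - a * quot1 y)"
        by (simp add: right_diff_distrib left_diff_distrib ac_simps)
      ultimately show "((\<lambda>x. (1 - quot x) * (1 + x\<^sup>2)) has_real_derivative
          y * (2 * (1 - quot y) - a * quot1 y)) (at y)"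
        by (metis (lifting))
      have "a * quot1 y \<le> 4 * quot1 y"
        using \<open>a \<le> 4\<close> quot1_pos[OF y] by (intro mult_right_mono) auto
      then show "0 < y * (2 * (1 - quot y) - a * quot1 y)"
        using quot1_bounds(2)[OF y] y by (intro mult_pos_pos) auto
    next
      have "((\<lambda>x. (1 - quot x) * (1 + x\<^sup>2)) \<longlongrightarrow> (1 - 0) * (1 + 0\<^sup>2)) (at_right 0)"
        by (intro tendsto_intros quot_tendsto_0)
      then show "((\<lambda>x. (1 - quot x) * (1 + x\<^sup>2)) \<longlongrightarrow> 1) (at_right 0)"
        by simp
    qed
    then have "quot x * (1 + 1 / x\<^sup>2) < 1"
      using x by (simp add: field_simps)
    then have "1 < (pair_density x)\<^sup>2"
      unfolding pair_density_square[OF x] using x quot_pos[OF x]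
      by (simp add: add_pos_nonneg)
    then show ?thesis
      using pair_density_pos[of x] by (metis less_imp_le one_power2 power2_less_imp_less)
  qed
  show ?thesis
    using *[of x] *[of "- x"] \<open>x \<noteq> 0\<close> by (cases "0 < x") (auto simp: pair_density_minus)
qed

text \<open>In terms of \<open>m\<close> the function \<open>E\<close> is
  \<open>exp (2 * m)\<close>, the integrating factor for \<open>V'' + 2 V' > 0\<close>. Two
  integrations from 0 give \<open>V' > exp (- 2 * m) / 2\<close> and
  \<open>V > (1 - exp (- 2 * m)) / 4\<close>. For \<open>a \<ge> 1\<close>, \<open>E x\<close> is at
  least \<open>1 + x\<^sup>2\<close>, which yields the bound.\<close>

lemma pair_density_less_2:
  assumes "1 \<le> a" "x \<noteq> 0"
  shows "pair_density x < 2"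
proof -
  define E where "E = (\<lambda>x :: real. (1 + x\<^sup>2) powr a)"
  have E_pos: "0 < E x" for x
    using one_plus_square_pos[of x] by (simp add: E_def)
  have E_deriv: "(E has_real_derivative 2 * rate x * E x) (at x)" for x
  proof -
    have "((\<lambda>x. 1 + x\<^sup>2) has_real_derivative 2 * x) (at x)"
      by (auto intro!: derivative_eq_intros)
    then have "(E has_real_derivative (1 + x\<^sup>2) powr a * (0 * ln (1 + x\<^sup>2) + (2 * x) * a / (1 + x\<^sup>2))) (at x)"
      unfolding E_def by (rule DERIV_powr) (simp_all add: one_plus_square_pos)
    then show ?thesis by (simp add: E_def rate_def ac_simps)
  qed
  have E_tendsto: "(E \<longlongrightarrow> 1) (at_right 0)"
  proof -
    have "isCont E 0" using DERIV_isCont E_deriv by blast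
    then show ?thesis
      by (auto simp: isCont_def E_def filterlim_at_split)
  qed
  have *: "1 / 2 < E x * quot1 x" if x: "0 < x" for x
  proof (rule gt_limit_at_right_0[OF _ _ _ x])
    fix y :: real assume y: "0 < y"
    show "((\<lambda>x. E x * quot1 x) has_real_derivative rate y * E y * (quot2 y + 2 * quot1 y)) (at y)"
      using DERIV_mult[OF E_deriv quot1_has_real_derivative[OF y]] by (simp add: algebra_simps)
    show "0 < rate y * E y * (quot2 y + 2 * quot1 y)"
      by (intro mult_pos_pos rate_pos E_pos quot2_bound y)
  next
    show "((\<lambda>x. E x * quot1 x) \<longlongrightarrow> 1 / 2) (at_right 0)"
      using tendsto_mult[OF E_tendsto quot1_tendsto] by simp
  qed
  have **: "1 / 4 < quot x + 1 / (4 * E x)" if x: "0 < x" for x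
  proof (rule gt_limit_at_right_0[OF _ _ _ x])
    fix y :: real assume y: "0 < y"
    have "((\<lambda>x. quot x + 1 / (4 * E x)) has_real_derivative
        rate y * quot1 y + - (4 * (2 * rate y * E y)) / (4 * E y * (4 * E y))) (at y)"
      using quot_has_real_derivative[OF y] E_pos[of y]
      by (auto intro!: derivative_eq_intros E_deriv)
    then show "((\<lambda>x. quot x + 1 / (4 * E x)) has_real_derivative
        rate y * ((E y * quot1 y - 1 / 2) / E y)) (at y)"
      using E_pos[of y] by (simp add: field_simps)
    show "0 < rate y * ((E y * quot1 y - 1 / 2) / E y)"
      using *[OF y] by (intro mult_pos_pos divide_pos_pos rate_pos E_pos y) auto
  next
    have "((\<lambda>x. quot x + 1 / (4 * E x)) \<longlongrightarrow> 0 + 1 / (4 * 1)) (at_right 0)"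
      by (intro tendsto_intros quot_tendsto_0 E_tendsto) auto
    then show "((\<lambda>x. quot x + 1 / (4 * E x)) \<longlongrightarrow> 1 / 4) (at_right 0)"
      by simp
  qed
  have ***: "pair_density x < 2" if x: "0 < x" for x
  proof -
    have "(1 + x\<^sup>2) powr 1 \<le> E x"
      unfolding E_def using \<open>1 \<le> a\<close> by (intro powr_mono) auto
    then have "1 / (4 * E x) \<le> 1 / (4 * (1 + x\<^sup>2))"
      using one_plus_square_pos[of x] E_pos[of x] by (intro divide_left_mono) auto
    then have "1 / 4 - 1 / (4 * (1 + x\<^sup>2)) < quot x"
      using **[OF x] by linarith
    also have "1 / 4 - 1 / (4 * (1 + x\<^sup>2)) = 1 / (4 * (1 + 1 / x\<^sup>2))"
      using one_plus_square_pos[of x] x by (simp add: field_simps)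
    finally have "1 < 4 * (quot x * (1 + 1 / x\<^sup>2))"
      using x by (simp add: field_simps add_pos_nonneg)
    moreover have "0 < quot x * (1 + 1 / x\<^sup>2)"
      using quot_pos[OF x] by (simp add: add_pos_nonneg)
    ultimately have "(pair_density x)\<^sup>2 < 2\<^sup>2"
      unfolding pair_density_square[OF x] by (simp add: divide_less_eq)
    then show ?thesis
      by (rule power2_less_imp_less) simp
  qed
  show ?thesis
    using ***[of x] ***[of "- x"] \<open>x \<noteq> 0\<close> by (cases "0 < x") (auto simp: pair_density_minus)
qed

text \<open>The inverse square \<open>f\<close> of the pair density increases: up to a positive
  factor its derivative is \<open>z\<^sup>2 * quot1 z * (a / 2) - quot z\<close>. This starts at 0
  and grows, because \<open>a \<le> 1\<close> and \<open>quot2_bound\<close> give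
  \<open>quot1 z + a / 2 * quot2 z > 0\<close>.\<close>

lemma pair_density_strict_antimono:
  assumes "a \<le> 1" "0 < x" "x < y"
  shows "pair_density y < pair_density x"
proof -
  have *: "0 < x\<^sup>2 * quot1 x * (a / 2) - quot x" if x: "0 < x" for x
  proof (rule gt_limit_at_right_0[OF _ _ _ x])
    fix y :: real assume y: "0 < y"
    have pos: "1 + y\<^sup>2 \<noteq> 0" using one_plus_square_pos[of y] by simp
    have rate: "a * y = rate y * (1 + y\<^sup>2)"
      using pos by (simp add: rate_def)
    have "((\<lambda>x. x\<^sup>2 * quot1 x * (a / 2) - quot x) has_real_derivative
        (2 * y * quot1 y + rate y * quot2 y * y\<^sup>2) * (a / 2) - rate y * quot1 y) (at y)"
      using quot_has_real_derivative[OF y] quot1_has_real_derivative[OF y]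
      by (auto intro!: derivative_eq_intros)
    also have "(2 * y * quot1 y + rate y * quot2 y * y\<^sup>2) * (a / 2) - rate y * quot1 y
        = (a * y) * quot1 y - rate y * quot1 y + rate y * y\<^sup>2 * (a / 2) * quot2 y"
      by (simp add: algebra_simps)
    also have "\<dots> = rate y * y\<^sup>2 * (quot1 y + a / 2 * quot2 y)"
      unfolding rate by (simp add: algebra_simps)
    finally show "((\<lambda>x. x\<^sup>2 * quot1 x * (a / 2) - quot x) has_real_derivative
        rate y * y\<^sup>2 * (quot1 y + a / 2 * quot2 y)) (at y)"
      by simp
    have "a / 2 * (quot2 y + 2 * quot1 y) > 0"
      using quot2_bound[OF y] a_pos by simp
    moreover have "a * quot1 y \<le> 1 * quot1 y"
      using \<open>a \<le> 1\<close> quot1_pos[OF y] by (intro mult_right_mono) auto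
    ultimately have "0 < quot1 y + a / 2 * quot2 y"
      by (simp add: distrib_left)
    then show "0 < rate y * y\<^sup>2 * (quot1 y + a / 2 * quot2 y)"
      using y rate_pos[OF y] by simp
  next
    have "((\<lambda>x. x\<^sup>2 * quot1 x * (a / 2) - quot x) \<longlongrightarrow> 0\<^sup>2 * (1 / 2) * (a / 2) - 0) (at_right 0)"
      by (intro tendsto_intros quot_tendsto_0 quot1_tendsto)
    then show "((\<lambda>x. x\<^sup>2 * quot1 x * (a / 2) - quot x) \<longlongrightarrow> 0) (at_right 0)"
      by simp
  qed
  define f where "f = (\<lambda>x. quot x * (1 + 1 / x\<^sup>2))"
  have "f x < f y"
  proof (rule DERIV_pos_imp_increasing[OF \<open>x < y\<close>])
    fix z assume "x \<le> z" "z \<le> y"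
    then have z: "0 < z" using \<open>0 < x\<close> by simp
    have pos: "1 + z\<^sup>2 \<noteq> 0" using one_plus_square_pos[of z] by simp
    have "((\<lambda>x. 1 + inverse (x\<^sup>2)) has_real_derivative - (2 / z ^ 3)) (at z)"
      using z by (auto intro!: derivative_eq_intros simp: field_simps power2_eq_square power3_eq_cube)
    from DERIV_mult[OF quot_has_real_derivative[OF z] this]
    have "(f has_real_derivative rate z * quot1 z * (1 + 1 / z\<^sup>2) + - (2 / z ^ 3) * quot z) (at z)"
      by (simp add: f_def inverse_eq_divide)
    moreover have "rate z * (1 + 1 / z\<^sup>2) = a / z"
    proof -
      have "1 + 1 / z\<^sup>2 = (1 + z\<^sup>2) / z\<^sup>2"
        using z by (simp add: field_simps)
      then show ?thesis
        using z pos by (simp add: rate_def power2_eq_square)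
    qed
    then have "rate z * quot1 z * (1 + 1 / z\<^sup>2) = a / z * quot1 z"
      by (metis mult.assoc mult.commute)
    ultimately have "(f has_real_derivative a / z * quot1 z + - (2 / z ^ 3) * quot z) (at z)"
      by simp
    moreover have "a / z * quot1 z + - (2 / z ^ 3) * quot z
        = 2 / z ^ 3 * (z\<^sup>2 * quot1 z * (a / 2) - quot z)"
      using z by (simp add: right_diff_distrib power2_eq_square power3_eq_cube)
    moreover have "0 < 2 / z ^ 3 * (z\<^sup>2 * quot1 z * (a / 2) - quot z)"
      using *[OF z] z by (intro mult_pos_pos divide_pos_pos) auto
    ultimately show "\<exists>d. (f has_real_derivative d) (at z) \<and> 0 < d"
      by auto
  qed
  moreover have "0 < f x"
    unfolding f_def using quot_pos[OF \<open>0 < x\<close>] by (simp add: add_pos_nonneg)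
  ultimately have "1 / f y < 1 / f x"
    by (intro divide_strict_left_mono) auto
  then have "(pair_density y)\<^sup>2 < (pair_density x)\<^sup>2"
    using assms by (simp add: pair_density_square f_def)
  then show ?thesis
    by (rule power2_less_imp_less) (simp add: pair_density_pos less_imp_le)
qed

lemma isCont_density_cos: "isCont (\<lambda>\<xi>. density (r * cos \<xi>)) \<xi>"
  by (intro isCont_o2[OF _ isCont_density] continuous_intros)

section \<open>Orbits\<close>

text \<open>Time along the circle of radius \<open>r\<close> as a function of the polar angle; the
  value at 0 makes the antiderivative unique.\<close>

definition clock :: "real \<Rightarrow> real \<Rightarrow> real" where
  "clock r = (SOME F. F 0 = 0 \<and> (\<forall>\<xi>. (F has_real_derivative density (r * cos \<xi>)) (at \<xi>)))"

lemma clock: "clock r 0 = 0" "(clock r has_real_derivative density (r * cos \<xi>)) (at \<xi>)"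
  using someI_ex[OF exists_antiderivative[OF isCont_density_cos, of 0 r]]
  by (auto simp: clock_def)

lemma clock_compose_has_real_derivative:
  assumes "(g has_real_derivative D) (at \<xi>)"
  shows "((\<lambda>\<xi>. clock r (g \<xi>)) has_real_derivative density (r * cos (g \<xi>)) * D) (at \<xi>)"
  by (rule DERIV_chain2[OF clock(2) assms])

text \<open>One quadrant stands for the whole circle: \<open>pair_density\<close> joins the
  coordinates \<open>C\<close> and \<open>- C\<close>, and the factor 2 accounts for the two signs
  of \<open>D\<close>.\<close>

definition period :: "real \<Rightarrow> real" where
  "period r = 2 * integral {0..pi / 2} (\<lambda>\<xi>. pair_density (r * cos \<xi>))"

lemma continuous_on_pair_density_cos: "continuous_on S (\<lambda>\<xi>. pair_density (r * cos \<xi>))"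
  by (intro continuous_at_imp_continuous_on ballI isCont_o2[OF _ isCont_pair_density] continuous_intros)

lemma clock_2pi: "clock r (2 * pi) = period r"
proof -
  \<comment> \<open>Reflections of the circle move a whole turn into one quadrant.\<close>
  define H where "H = (\<lambda>\<xi>. clock r \<xi> + clock r (\<xi> + pi) - clock r (pi - \<xi>) - clock r (2 * pi - \<xi>))"
  have "(H has_real_derivative 2 * pair_density (r * cos \<xi>)) (at \<xi>)" for \<xi>
    unfolding H_def
    by (rule derivative_eq_intros clock(2) clock_compose_has_real_derivative refl)+
      (simp add: pair_density_def cos_diff)
  then have "((\<lambda>\<xi>. 2 * pair_density (r * cos \<xi>)) has_integral (H (pi / 2) - H 0)) {0..pi / 2}"
    by (intro fundamental_theorem_of_calculus)
      (auto simp: has_real_derivative_iff_has_vector_derivative[symmetric] intro: DERIV_subset)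
  then have "integral {0..pi / 2} (\<lambda>\<xi>. 2 * pair_density (r * cos \<xi>)) = H (pi / 2) - H 0"
    by (rule integral_unique)
  moreover have "H (pi / 2) = 0" "H 0 = - clock r (2 * pi)"
    by (simp_all add: H_def clock(1) field_simps)
  ultimately show ?thesis
    by (simp add: period_def)
qed

lemma clock_plus_2pi: "clock r (\<xi> + 2 * pi) = clock r \<xi> + period r"
proof -
  have "((\<lambda>\<xi>. clock r (\<xi> + 2 * pi) - clock r \<xi>) has_real_derivative 0) (at \<xi>)" for \<xi>
    by (rule derivative_eq_intros clock(2) clock_compose_has_real_derivative refl)+ simp
  from zero_derivative_const[OF this, of \<xi> 0] show ?thesis
    by (simp add: clock clock_2pi)
qed

lemma clock_2pi_mult: "clock r (\<xi> + 2 * pi * real k) = clock r \<xi> + real k * period r"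
proof (induction k)
  case (Suc k)
  have "\<xi> + 2 * pi * real (Suc k) = (\<xi> + 2 * pi * real k) + 2 * pi"
    by (simp add: algebra_simps)
  then show ?case
    by (simp only: clock_plus_2pi Suc.IH) (simp add: algebra_simps)
qed simp

lemma strict_mono_clock: "strict_mono (clock r)"
  by (rule strict_monoI) (metis DERIV_pos_imp_increasing clock(2) density_pos)

lemma period_pos: "0 < period r"
  using strict_mono_less[OF strict_mono_clock, of r 0 "2 * pi"] by (simp add: clock clock_2pi)

lemma surj_clock: "surj (clock r)"
proof -
  have "\<exists>\<xi>. clock r \<xi> = t" for t
  proof -
    obtain k where "\<bar>t\<bar> / period r \<le> real k"
      using real_arch_simple by blast
    then have k: "\<bar>t\<bar> \<le> real k * period r"
      using period_pos[of r] by (simp add: pos_divide_le_eq)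
    have "clock r (- (2 * pi * real k)) + real k * period r = 0"
      using clock_2pi_mult[of r "- (2 * pi * real k)" k] by (simp add: clock)
    moreover have "clock r (2 * pi * real k) = real k * period r"
      using clock_2pi_mult[of r 0 k] by (simp add: clock)
    ultimately have "clock r (- (2 * pi * real k)) \<le> t" "t \<le> clock r (2 * pi * real k)"
      using k by (simp_all add: abs_le_iff)
    moreover have "continuous_on A (clock r)" for A
      by (meson DERIV_isCont clock(2) continuous_at_imp_continuous_on)
    ultimately show ?thesis
      using IVT'[of "clock r" "- (2 * pi * real k)" t "2 * pi * real k"] by force
  qed
  then show ?thesis by (metis surjI)
qed

definition angle :: "real \<Rightarrow> real \<Rightarrow> real" where
  "angle r = inv (clock r)"

lemma angle_clock [simp]: "angle r (clock r \<xi>) = \<xi>"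
  by (simp add: angle_def strict_mono_clock strict_mono_imp_inj_on)

lemma clock_angle [simp]: "clock r (angle r t) = t"
  by (simp add: angle_def surj_clock surj_f_inv_f)

lemma angle_0 [simp]: "angle r 0 = 0"
  using angle_clock[of r 0] by (simp add: clock del: angle_clock)

lemma angle_has_real_derivative:
  "(angle r has_real_derivative inverse (density (r * cos (angle r t)))) (at t)"
  unfolding angle_def by (rule inv_has_real_derivative(2)[OF clock(2) density_pos surj_clock])

lemma angle_plus_period: "angle r (t + real k * period r) = angle r t + 2 * pi * real k"
  by (metis angle_clock clock_2pi_mult clock_angle)

definition orbit :: "real \<Rightarrow> real \<Rightarrow> real" where
  "orbit r t = height (r * cos (angle r t))"

definition orbit' :: "real \<Rightarrow> real \<Rightarrow> real" where
  "orbit' r t = - (r * sin (angle r t)) / sqrt (1 + (r * cos (angle r t))\<^sup>2)"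

definition flow :: "(real \<Rightarrow> real) \<Rightarrow> (real \<Rightarrow> real) \<Rightarrow> bool" where
  "flow u u' \<longleftrightarrow> (\<forall>t. (u has_real_derivative u' t) (at t) \<and>
    (u' has_real_derivative (exp (- a * u t) - 1) * (1 + (u' t)\<^sup>2)) (at t))"

text \<open>The quotient is the angular speed. Multiplying it by \<open>coord u\<close> cancels the
  denominator in \<open>dcoord\<close>, so the rotation law for \<open>D\<close> matches the
  equation also at \<open>u = 0\<close>.\<close>

lemma coord_times_speed:
  "coord u * (dcoord u / sqrt (1 + (coord u)\<^sup>2)) = sqrt (1 + (coord u)\<^sup>2) * (1 - exp (- a * u))"
proof (cases "u = 0")
  case False
  define s where "s = sqrt (1 + (coord u)\<^sup>2)"
  have s: "0 < s" "s * s = 1 + (coord u)\<^sup>2"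
    using one_plus_square_pos[of "coord u"] by (simp_all add: s_def)
  have "dcoord u = s * s * (1 - exp (- a * u)) / coord u"
    using False by (simp add: dcoord_def coord_square s)
  then show ?thesis
    using s(1) coord_nonzero[OF False] by (simp flip: s_def)
qed simp

lemma sqrt_coord_has_real_derivative:
  assumes "(f has_real_derivative D) (at t)"
  shows "((\<lambda>t. sqrt (1 + (f t)\<^sup>2)) has_real_derivative f t * D / sqrt (1 + (f t)\<^sup>2)) (at t)"
proof -
  have "((\<lambda>t. 1 + (f t)\<^sup>2) has_real_derivative 2 * f t * D) (at t)"
    using assms by (auto intro!: derivative_eq_intros)
  then show ?thesis
    by (intro DERIV_cong[OF DERIV_chain2[where f = sqrt, OF DERIV_real_sqrt]])
      (auto simp: inverse_eq_divide one_plus_square_pos)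
qed

lemma flow_orbit: "flow (orbit r) (orbit' r)"
  unfolding flow_def
proof (intro allI conjI)
  fix t
  define C S s w v where "C = r * cos (angle r t)" and "S = r * sin (angle r t)"
    and "s = sqrt (1 + C\<^sup>2)" and "w = dcoord (height C) / s" and "v = exp (- a * height C)"
  have s: "0 < s"
    using one_plus_square_pos[of C] by (simp add: s_def)
  have angle: "(angle r has_real_derivative w) (at t)"
    using angle_has_real_derivative[of r t] by (simp add: density_def w_def s_def C_def)
  have C: "((\<lambda>t. r * cos (angle r t)) has_real_derivative - S * w) (at t)"
    using angle by (auto intro!: derivative_eq_intros simp: S_def)
  have S: "((\<lambda>t. - (r * sin (angle r t))) has_real_derivative - C * w) (at t)"
    using angle by (auto intro!: derivative_eq_intros simp: C_def)
  have "(orbit r has_real_derivative inverse (dcoord (height C)) * (- S * w)) (at t)"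
    unfolding orbit_def[abs_def] C_def by (rule DERIV_chain2[OF height_has_real_derivative C])
  moreover have "inverse (dcoord (height C)) * (- S * w) = orbit' r t"
    using dcoord_pos[of "height C"] by (simp add: w_def orbit'_def S_def s_def C_def)
  ultimately show "(orbit r has_real_derivative orbit' r t) (at t)"
    by simp
  have sqrt: "((\<lambda>t. sqrt (1 + (r * cos (angle r t))\<^sup>2)) has_real_derivative C * (- S * w) / s) (at t)"
    using sqrt_coord_has_real_derivative[OF C] by (simp add: C_def s_def)
  have "(orbit' r has_real_derivative (- C * w * s - - S * (C * (- S * w) / s)) / (s * s)) (at t)"
    unfolding orbit'_def[abs_def]
    by (rule DERIV_cong[OF DERIV_divide[OF S sqrt]]) (use s in \<open>simp_all add: C_def S_def s_def\<close>)
  also have "(- C * w * s - - S * (C * (- S * w) / s)) / (s * s) = - (C * w) / s * (1 + (S / s)\<^sup>2)"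
    using s by (simp add: field_simps power2_eq_square)
  also have "C * w = s * (1 - v)"
    using coord_times_speed[of "height C"] by (simp add: w_def s_def v_def)
  also have "- (s * (1 - v)) / s = v - 1"
    using s by simp
  also have "(S / s)\<^sup>2 = (orbit' r t)\<^sup>2"
    by (simp add: orbit'_def S_def s_def C_def power_divide)
  finally show "(orbit' r has_real_derivative
      (exp (- a * orbit r t) - 1) * (1 + (orbit' r t)\<^sup>2)) (at t)"
    by (simp add: v_def orbit_def C_def)
qed

lemma orbit_plus_period: "orbit r (t + real k * period r) = orbit r t"
proof -
  have "2 * pi * real k = 2 * real k * pi"
    by simp
  then show ?thesis
    unfolding orbit_def angle_plus_period by (simp only: cos_add cos_2npi sin_2npi) simp
qed

text \<open>Along any solution \<open>C' = - D * w\<close> and \<open>D' = C * w\<close>, a rotation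
  with variable speed \<open>w\<close>. Integrating \<open>w\<close> gives the angle explicitly,
  which takes the place of a uniqueness theorem.\<close>

lemma flow_is_orbit:
  assumes "flow u u'"
  obtains r t\<^sub>0 where "0 \<le> r" "\<And>t. u t = orbit r (t + t\<^sub>0)"
proof -
  define C s D w where "C = (\<lambda>t. coord (u t))" and "s = (\<lambda>t. sqrt (1 + (C t)\<^sup>2))"
    and "D = (\<lambda>t. - s t * u' t)" and "w = (\<lambda>t. dcoord (u t) / s t)"
  have u: "(u has_real_derivative u' t) (at t)"
    and u': "(u' has_real_derivative (exp (- a * u t) - 1) * (1 + (u' t)\<^sup>2)) (at t)" for t
    using assms by (auto simp: flow_def)
  have s: "0 < s t" for t
    using one_plus_square_pos[of "C t"] by (simp add: s_def)
  have Cw: "C t * w t = s t * (1 - exp (- a * u t))" for t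
    using coord_times_speed[of "u t"] by (simp add: C_def w_def s_def)
  have C: "(C has_real_derivative - D t * w t) (at t)" for t
    using DERIV_chain2[OF coord_has_real_derivative u[of t]] s[of t]
    by (simp add: C_def D_def w_def mult.commute)
  have D: "(D has_real_derivative C t * w t) (at t)" for t
  proof -
    have "(s has_real_derivative C t * (- D t * w t) / s t) (at t)"
      unfolding s_def by (rule sqrt_coord_has_real_derivative[OF C])
    from DERIV_mult[OF DERIV_minus[OF this] u'[of t]]
    have "(D has_real_derivative - (C t * (- D t * w t) / s t) * u' t
        + (exp (- a * u t) - 1) * (1 + (u' t)\<^sup>2) * - s t) (at t)"
      by (simp add: D_def)
    also have "- (C t * (- D t * w t) / s t) * u' t = - (C t * w t) * (u' t)\<^sup>2"
      using s[of t] by (simp add: D_def power2_eq_square)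
    also have "(exp (- a * u t) - 1) * (1 + (u' t)\<^sup>2) * - s t = C t * w t * (1 + (u' t)\<^sup>2)"
      unfolding Cw by (simp add: algebra_simps)
    finally show ?thesis
      by (simp add: algebra_simps)
  qed
  have isCont_w: "isCont w t" for t
    unfolding w_def s_def
  proof (rule isCont_divide)
    show "isCont (\<lambda>t. dcoord (u t)) t"
      by (rule isCont_o2[OF DERIV_isCont[OF u] isCont_dcoord])
    show "isCont (\<lambda>t. sqrt (1 + (C t)\<^sup>2)) t"
      using DERIV_isCont[OF C] by (intro continuous_intros)
    show "sqrt (1 + (C t)\<^sup>2) \<noteq> 0"
      using s[of t] by (simp add: s_def)
  qed
  obtain q \<phi> where q: "C 0 = q * cos \<phi>" "D 0 = q * sin \<phi>"
    using polar_Ex by blast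
  \<comment> \<open>The polar radius \<open>q\<close> may be negative; a half turn of the angle
    makes it nonnegative.\<close>
  define r \<xi>\<^sub>0 where "r = \<bar>q\<bar>" and "\<xi>\<^sub>0 = (if 0 \<le> q then \<phi> else \<phi> + pi)"
  have \<xi>\<^sub>0: "C 0 = r * cos \<xi>\<^sub>0" "D 0 = r * sin \<xi>\<^sub>0"
    by (simp_all add: r_def \<xi>\<^sub>0_def q)
  obtain \<xi> where \<xi>: "\<xi> 0 = \<xi>\<^sub>0" "\<And>t. (\<xi> has_real_derivative w t) (at t)"
    using exists_antiderivative[OF isCont_w] by blast
  \<comment> \<open>Rotating \<open>(C, D)\<close> back by the accumulated angle freezes it at
    \<open>(r, 0)\<close>.\<close>
  define P Q where "P = (\<lambda>t. C t * cos (\<xi> t) + D t * sin (\<xi> t))"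
    and "Q = (\<lambda>t. D t * cos (\<xi> t) - C t * sin (\<xi> t))"
  have "(P has_real_derivative 0) (at t)" for t
    unfolding P_def using C[of t] D[of t] \<xi>(2)[of t]
    by (auto intro!: derivative_eq_intros simp: algebra_simps)
  then have "P t = P 0" for t
    by (rule zero_derivative_const)
  moreover have "(Q has_real_derivative 0) (at t)" for t
    unfolding Q_def using C[of t] D[of t] \<xi>(2)[of t]
    by (auto intro!: derivative_eq_intros simp: algebra_simps)
  then have "Q t = Q 0" for t
    by (rule zero_derivative_const)
  moreover have "P 0 = r * ((cos \<xi>\<^sub>0)\<^sup>2 + (sin \<xi>\<^sub>0)\<^sup>2)" "Q 0 = 0"
    unfolding P_def Q_def \<xi> \<xi>\<^sub>0 by algebra+
  ultimately have PQ: "P t = r" "Q t = 0" for t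
    by simp_all
  have C_eq: "C t = r * cos (\<xi> t)" for t
  proof -
    have "P t * cos (\<xi> t) - Q t * sin (\<xi> t) = C t * ((cos (\<xi> t))\<^sup>2 + (sin (\<xi> t))\<^sup>2)"
      unfolding P_def Q_def by algebra
    then show ?thesis by (simp add: PQ)
  qed
  have u_eq: "u t = height (r * cos (\<xi> t))" for t
    by (metis C_def C_eq height_coord)
  \<comment> \<open>The clock reading at angle \<open>\<xi> t\<close> runs at unit speed, so
    \<open>\<xi>\<close> is \<open>angle r\<close> up to a time shift.\<close>
  have "((\<lambda>t. clock r (\<xi> t) - t) has_real_derivative 0) (at t)" for t
  proof -
    have "density (r * cos (\<xi> t)) * w t = 1"
      using s[of t] dcoord_pos[of "u t"]
      by (simp add: density_def w_def s_def C_def flip: C_eq)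
    then show ?thesis
      using DERIV_diff[OF clock_compose_has_real_derivative[OF \<xi>(2), of r t] DERIV_ident] by simp
  qed
  from zero_derivative_const[OF this, of _ 0] have "clock r (\<xi> t) = t + clock r \<xi>\<^sub>0" for t
    by (metis \<xi>(1) add.commute diff_eq_eq diff_zero)
  then have "\<xi> t = angle r (t + clock r \<xi>\<^sub>0)" for t
    by (metis angle_clock)
  then have "u t = orbit r (t + clock r \<xi>\<^sub>0)" for t
    by (simp add: u_eq orbit_def)
  then show thesis
    by (rule that[rotated]) (simp add: r_def)
qed

text \<open>At time 0 the orbit is at its maximum, where the coordinate is \<open>r\<close>; this
  value recurs only after full turns, so a single return suffices.\<close>

lemma orbit_periodic_imp:
  assumes "0 < r" "0 < p" "orbit r p = orbit r 0"
  obtains k :: nat where "0 < k" "p = real k * period r"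
proof -
  have "r * cos (angle r p) = r"
    using assms coord_height[of "r * cos (angle r p)"] by (simp add: orbit_def)
  then have "cos (angle r p) = 1"
    using \<open>0 < r\<close> by simp
  then obtain k :: int where k: "angle r p = 2 * pi * real_of_int k"
    by (auto simp: cos_one_2pi_int mult.commute mult.left_commute)
  have "clock r 0 < clock r (angle r p)"
    using \<open>0 < p\<close> by (simp add: clock)
  then have "0 < angle r p"
    using strict_mono_less[OF strict_mono_clock] by blast
  then have "0 < k"
    by (simp add: k zero_less_mult_iff)
  then have "angle r p = 0 + 2 * pi * real (nat k)"
    by (simp add: k)
  then have "p = real (nat k) * period r"
    by (metis clock(1) add_0 clock_2pi_mult clock_angle)
  then show thesis
    using that[of "nat k"] \<open>0 < k\<close> by simp
qed

section \<open>The period\<close>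

text \<open>The strict bounds on the pair density hold away from coordinate 0, hence the restriction
  to \<open>0 < cos \<xi>\<close>, which leaves out the endpoint \<open>pi / 2\<close>.\<close>

lemma integral_quarter_less:
  fixes f g :: "real \<Rightarrow> real"
  assumes "continuous_on {0..pi / 2} f" "continuous_on {0..pi / 2} g"
    and "\<And>\<xi>. 0 < cos \<xi> \<Longrightarrow> f \<xi> < g \<xi>"
  shows "integral {0..pi / 2} f < integral {0..pi / 2} g"
proof (rule integral_less_real)
  show "{0<..<pi / 2} \<noteq> {}"
    using pi_half_gt_zero by (simp only: greaterThanLessThan_empty_iff not_le)
  fix \<xi> :: real assume "\<xi> \<in> {0<..<pi / 2}"
  then show "f \<xi> < g \<xi>"
    by (intro assms(3) cos_gt_zero) simp_all
qed (fact assms)+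

lemma period_gt_pi:
  assumes "a \<le> 4" "0 < r"
  shows "pi < period r"
proof -
  have "integral {0..pi / 2} (\<lambda>_. 1 :: real) < integral {0..pi / 2} (\<lambda>\<xi>. pair_density (r * cos \<xi>))"
    by (intro integral_quarter_less pair_density_gt_1 continuous_on_pair_density_cos continuous_on_const)
      (use assms in auto)
  then show ?thesis by (simp add: period_def)
qed

lemma period_less_2pi:
  assumes "1 \<le> a" "0 < r"
  shows "period r < 2 * pi"
proof -
  have "integral {0..pi / 2} (\<lambda>\<xi>. pair_density (r * cos \<xi>)) < integral {0..pi / 2} (\<lambda>_. 2 :: real)"
    by (intro integral_quarter_less pair_density_less_2 continuous_on_pair_density_cos continuous_on_const)
      (use assms in auto)
  then show ?thesis by (simp add: period_def)
qed

lemma period_strict_antimono: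
  assumes "a \<le> 1" "0 < r" "r < s"
  shows "period s < period r"
proof -
  have "integral {0..pi / 2} (\<lambda>\<xi>. pair_density (s * cos \<xi>))
      < integral {0..pi / 2} (\<lambda>\<xi>. pair_density (r * cos \<xi>))"
    by (intro integral_quarter_less pair_density_strict_antimono continuous_on_pair_density_cos)
      (use assms in auto)
  then show ?thesis by (simp add: period_def)
qed

lemma period_0: "period 0 = 2 * pi / sqrt a"
  by (simp add: period_def pair_density_0)

lemma continuous_on_period: "continuous_on S period"
proof -
  have "continuous_on UNIV pair_density"
    by (simp add: continuous_at_imp_continuous_on isCont_pair_density)
  then have "continuous_on (S \<times> cbox 0 (pi / 2)) (\<lambda>(r, \<xi>). pair_density (r * cos \<xi>))"
    unfolding split_beta by (rule continuous_on_compose2) (auto intro!: continuous_intros)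
  from integral_continuous_on_param[OF this] show ?thesis
    unfolding period_def[abs_def] box_real by (intro continuous_intros)
qed

section \<open>The period at large radius\<close>

lemma filterlim_height: "filterlim height at_top at_top"
  unfolding filterlim_at_top
proof
  fix Z
  show "\<forall>\<^sub>F x in at_top. Z \<le> height x"
    using eventually_ge_at_top[of "coord Z"]
    by eventually_elim (metis height_coord strict_mono_height strict_mono_less_eq)
qed

lemma filterlim_height_minus: "filterlim (\<lambda>x. height (- x)) at_bot at_top"
  unfolding filterlim_at_bot
proof
  fix Z
  show "\<forall>\<^sub>F x in at_top. height (- x) \<le> Z"
    using eventually_ge_at_top[of "- coord Z"]
    by eventually_elim (metis height_coord minus_le_iff strict_mono_height strict_mono_less_eq)
qed

lemma pair_density_tendsto_1: "(pair_density \<longlongrightarrow> 1) at_top"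
proof -
  have "filterlim (\<lambda>x. - a * height x) at_bot at_top"
    using filterlim_tendsto_neg_mult_at_bot[OF tendsto_const _ filterlim_height, of "- a"] a_pos by simp
  then have "((\<lambda>x. exp (- a * height x)) \<longlongrightarrow> 0) at_top"
    by (rule filterlim_compose[OF exp_at_bot])
  then have "((\<lambda>x. 1 / (1 - exp (- a * height x))) \<longlongrightarrow> 1 / (1 - 0)) at_top"
    by (intro tendsto_intros) auto
  then have beta: "(beta \<longlongrightarrow> 1) at_top"
    by (simp add: beta_def[abs_def])
  have "filterlim (\<lambda>x. - a * height (- x)) at_top at_top"
    using filterlim_tendsto_pos_mult_at_bot[OF tendsto_const a_pos filterlim_height_minus]
    by (simp add: filterlim_uminus_at_top)
  then have "filterlim (\<lambda>x. exp (- a * height (- x))) at_top at_top"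
    by (rule filterlim_compose[OF exp_at_top])
  then have "filterlim (\<lambda>x. - 1 + exp (- a * height (- x))) at_top at_top"
    by (rule filterlim_tendsto_add_at_top[OF tendsto_const])
  then have "((\<lambda>x. inverse (- 1 + exp (- a * height (- x)))) \<longlongrightarrow> 0) at_top"
    by (rule tendsto_inverse_0_at_top)
  then have alpha: "(alpha \<longlongrightarrow> 0) at_top"
    by (simp add: alpha_def[abs_def] inverse_eq_divide)
  have "((\<lambda>x :: real. x / sqrt (1 + x\<^sup>2)) \<longlongrightarrow> 1) at_top"
    by real_asymp
  then have "((\<lambda>x. x / sqrt (1 + x\<^sup>2) * (alpha x + beta x)) \<longlongrightarrow> 1 * (0 + 1)) at_top"
    by (intro tendsto_intros alpha beta)
  moreover have "\<forall>\<^sub>F x in at_top. x / sqrt (1 + x\<^sup>2) * (alpha x + beta x) = pair_density x"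
    using eventually_gt_at_top[of 0] by eventually_elim (simp add: pair_density_eq)
  ultimately show ?thesis
    using Lim_transform_eventually by force
qed

text \<open>Provides the constant majorant for dominated convergence: by monotonicity the supremum
  is the value at 0.\<close>

lemma pair_density_le:
  assumes "a \<le> 1"
  shows "pair_density x \<le> 2 / sqrt a"
proof -
  have *: "pair_density x \<le> 2 / sqrt a" if "0 < x" for x
  proof (rule tendsto_lowerbound)
    show "(pair_density \<longlongrightarrow> 2 / sqrt a) (at_right 0)"
      using isCont_pair_density[of 0] by (simp add: isCont_def pair_density_0 filterlim_at_split)
    show "\<forall>\<^sub>F y in at_right 0. pair_density x \<le> pair_density y"
      unfolding eventually_at_right_field
      by (rule exI[of _ x]) (use that assms in \<open>auto intro: less_imp_le pair_density_strict_antimono\<close>)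
  qed simp
  show ?thesis
    using *[of x] *[of "- x"] by (cases x "0 :: real" rule: linorder_cases)
      (auto simp: pair_density_minus pair_density_0)
qed

lemma exists_period_less_2pi:
  assumes "a \<le> 1"
  obtains r where "0 < r" "period r < 2 * pi"
proof -
  \<comment> \<open>At \<open>pi / 2\<close> the coordinate is 0 for every radius, so the pointwise
    limit differs from 1 at this single point.\<close>
  define g where "g = (\<lambda>\<xi> :: real. if \<xi> = pi / 2 then 2 / sqrt a else 1)"
  have "(\<lambda>k. integral {0..pi / 2} (\<lambda>\<xi>. pair_density (real k * cos \<xi>)))
      \<longlonglongrightarrow> integral {0..pi / 2} g"
  proof (rule dominated_convergence)
    show "(\<lambda>\<xi>. pair_density (real k * cos \<xi>)) integrable_on {0..pi / 2}" for k
      by (rule integrable_continuous_real[OF continuous_on_pair_density_cos])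
    show "(\<lambda>_. 2 / sqrt a) integrable_on {0..pi / 2}"
      by (rule integrable_const_ivl)
    show "norm (pair_density (real k * cos \<xi>)) \<le> 2 / sqrt a" for k \<xi>
      using pair_density_le[OF assms] pair_density_pos by (simp add: abs_of_pos)
    show "(\<lambda>k. pair_density (real k * cos \<xi>)) \<longlonglongrightarrow> g \<xi>" if \<xi>: "\<xi> \<in> {0..pi / 2}" for \<xi>
    proof (cases "\<xi> = pi / 2")
      case True
      show ?thesis unfolding True by (simp add: g_def pair_density_0)
    next
      case False
      then have "0 < cos \<xi>"
        using \<xi> by (intro cos_gt_zero_pi) auto
      then have "filterlim (\<lambda>k. cos \<xi> * real k) at_top sequentially"
        by (intro filterlim_tendsto_pos_mult_at_top[OF tendsto_const] filterlim_real_sequentially)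
      then have "filterlim (\<lambda>k. real k * cos \<xi>) at_top sequentially"
        by (simp add: mult.commute)
      then show ?thesis
        using False filterlim_compose[OF pair_density_tendsto_1] by (simp add: g_def)
    qed
  qed
  moreover have "integral {0..pi / 2} g = integral {0..pi / 2} (\<lambda>_. 1)"
    by (rule integral_spike[of "{pi / 2}"]) (auto simp: g_def)
  ultimately have "(\<lambda>k. 2 * integral {0..pi / 2} (\<lambda>\<xi>. pair_density (real k * cos \<xi>)))
      \<longlonglongrightarrow> 2 * (pi / 2)"
    by (intro tendsto_mult_left) simp
  then have "(\<lambda>k. period (real k)) \<longlonglongrightarrow> pi"
    by (simp add: period_def)
  then have "\<forall>\<^sub>F k in sequentially. period (real k) < 2 * pi"
    by (rule order_tendstoD) simp
  then have "\<forall>\<^sub>F k in sequentially. 0 < k \<and> period (real k) < 2 * pi"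
    using eventually_gt_at_top[of 0] by eventually_elim simp
  then obtain k where "0 < k" "period (real k) < 2 * pi"
    using eventually_happens'[OF sequentially_bot] by blast
  then show thesis
    using that[of "real k"] by simp
qed

text \<open>Since \<open>ln t < t / 2\<close>, the relation \<open>m = t - 1 - ln t\<close> gives
  \<open>t - 1 < 1 + 2 * m\<close>. Thus \<open>alpha\<close> decays at most logarithmically in
  \<open>x\<close>, while \<open>beta\<close> stays above 1.\<close>

lemma pair_density_lower_bound:
  assumes "0 < x"
  shows "x / sqrt (1 + x\<^sup>2) * (1 + 1 / (1 + a * ln (1 + x\<^sup>2))) < pair_density x"
proof -
  define t where "t = exp (- (a * height (- x)))"
  have t: "1 < t"
    using mult_pos_neg[OF a_pos height_neg[of "- x"]] assms by (simp add: t_def)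
  have "pot (height x) = t - 1 - ln t"
    using pot_height_minus[of x] by (simp add: pot_def t_def)
  moreover have "2 * pot (height x) / a = ln (1 + x\<^sup>2)"
    using exp_pot_height[of x] by (metis ln_exp)
  then have "2 * pot (height x) = a * ln (1 + x\<^sup>2)"
    using a_pos by (simp add: field_simps)
  moreover have "ln (t / 2) \<le> t / 2 - 1"
    using t by (intro ln_le_minus_one) auto
  then have "ln t \<le> t / 2 - 1 + ln 2"
    using t by (simp add: ln_div)
  moreover have "ln 2 < (1 :: real)"
    using ln_2_less_1 by simp
  ultimately have "t - 1 < 1 + a * ln (1 + x\<^sup>2)"
    by linarith
  then have "1 / (1 + a * ln (1 + x\<^sup>2)) < alpha x"
    using t by (simp add: alpha_def divide_strict_left_mono flip: t_def)
  then have "1 + 1 / (1 + a * ln (1 + x\<^sup>2)) < alpha x + beta x"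
    using alpha_beta_bounds(2)[OF assms] by linarith
  then show ?thesis
    unfolding pair_density_eq[OF assms] using assms sqrt_one_plus_square_pos[of x]
    by (intro mult_strict_left_mono) auto
qed

text \<open>The logarithmic factor is smallest at the full radius and can be pulled out as
  \<open>c\<close>. The remaining integrand \<open>f\<close> has the antiderivative
  \<open>F\<close>, which rises from 0 to \<open>arctan r\<close>.\<close>

lemma period_lower_bound:
  assumes "0 < r"
  shows "2 * (1 + 1 / (1 + a * ln (1 + r\<^sup>2))) * arctan r < period r"
proof -
  define c where "c = 1 + 1 / (1 + a * ln (1 + r\<^sup>2))"
  define f where "f = (\<lambda>\<xi>. r * cos \<xi> / sqrt (1 + (r * cos \<xi>)\<^sup>2))"
  define F where "F = (\<lambda>\<xi>. arctan (r * sin \<xi> / sqrt (1 + (r * cos \<xi>)\<^sup>2)))"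
  have F: "(F has_real_derivative f \<xi>) (at \<xi>)" for \<xi>
  proof -
    define S C s where "S = r * sin \<xi>" and "C = r * cos \<xi>" and "s = sqrt (1 + C\<^sup>2)"
    have s: "0 < s" "s\<^sup>2 = 1 + C\<^sup>2"
      using one_plus_square_pos[of C] by (simp_all add: s_def)
    have dS: "((\<lambda>\<xi>. r * sin \<xi>) has_real_derivative C) (at \<xi>)"
      and dC: "((\<lambda>\<xi>. r * cos \<xi>) has_real_derivative - S) (at \<xi>)"
      unfolding S_def C_def by (auto intro!: derivative_eq_intros)
    have "((\<lambda>\<xi>. r * sin \<xi> / sqrt (1 + (r * cos \<xi>)\<^sup>2)) has_real_derivative
        (C * s - S * (C * - S / s)) / (s * s)) (at \<xi>)"
      by (rule DERIV_cong[OF DERIV_divide[OF dS sqrt_coord_has_real_derivative[OF dC]]])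
        (use s in \<open>simp_all add: S_def C_def s_def\<close>)
    from DERIV_chain2[OF DERIV_arctan this]
    have "(F has_real_derivative
        inverse (1 + (S / s)\<^sup>2) * ((C * s - S * (C * - S / s)) / (s * s))) (at \<xi>)"
      by (simp add: F_def S_def C_def s_def)
    moreover have "inverse (1 + (S / s)\<^sup>2) * ((C * s - S * (C * - S / s)) / (s * s)) = C / s"
    proof -
      have "(C * s - S * (C * - S / s)) / (s * s) = C / s * (1 + (S / s)\<^sup>2)"
        using s(1) by (simp add: field_simps power2_eq_square)
      then show ?thesis
        using one_plus_square_pos[of "S / s"] by simp
    qed
    ultimately show ?thesis
      by (simp add: f_def C_def s_def)
  qed
  then have "(f has_integral (F (pi / 2) - F 0)) {0..pi / 2}"
    by (intro fundamental_theorem_of_calculus)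
      (auto simp: has_real_derivative_iff_has_vector_derivative[symmetric] intro: DERIV_subset)
  then have "integral {0..pi / 2} (\<lambda>\<xi>. f \<xi> * c) = arctan r * c"
    by (simp add: F_def integral_unique)
  moreover have "integral {0..pi / 2} (\<lambda>\<xi>. f \<xi> * c) < integral {0..pi / 2} (\<lambda>\<xi>. pair_density (r * cos \<xi>))"
  proof (rule integral_quarter_less)
    show "continuous_on {0..pi / 2} (\<lambda>\<xi>. f \<xi> * c)"
      unfolding f_def using sqrt_one_plus_square_pos[of "r * cos _"]
      by (intro continuous_intros) (simp add: less_imp_neq[symmetric])
    fix \<xi> :: real assume "0 < cos \<xi>"
    then have x: "0 < r * cos \<xi>" using assms by simp
    have "(r * cos \<xi>)\<^sup>2 \<le> r\<^sup>2"
      using x assms by (intro power_mono) (auto intro: mult_left_le)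
    then have "a * ln (1 + (r * cos \<xi>)\<^sup>2) \<le> a * ln (1 + r\<^sup>2)"
      using a_pos one_plus_square_pos[of "r * cos \<xi>"] one_plus_square_pos[of r] by simp
    moreover have "0 \<le> a * ln (1 + (r * cos \<xi>)\<^sup>2)"
      using a_pos by simp
    ultimately have "c \<le> 1 + 1 / (1 + a * ln (1 + (r * cos \<xi>)\<^sup>2))"
      unfolding c_def by (intro add_left_mono divide_left_mono mult_pos_pos) linarith+
    then have "f \<xi> * c \<le> f \<xi> * (1 + 1 / (1 + a * ln (1 + (r * cos \<xi>)\<^sup>2)))"
      unfolding f_def using x by (intro mult_left_mono) auto
    also have "\<dots> < pair_density (r * cos \<xi>)"
      using pair_density_lower_bound[OF x] by (simp only: f_def)
    finally show "f \<xi> * c < pair_density (r * cos \<xi>)" .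
  qed (auto simp: continuous_on_pair_density_cos)
  ultimately have "arctan r * c < integral {0..pi / 2} (\<lambda>\<xi>. pair_density (r * cos \<xi>))"
    by (simp only:)
  then have "2 * (arctan r * c) < period r"
    by (simp add: period_def)
  then show ?thesis
    by (simp add: c_def ac_simps)
qed

text \<open>\<open>2 * arctan r\<close> falls short of \<open>pi\<close> only by order
  \<open>1 / r\<close>, whereas the gain from the factor is of order \<open>1 / ln r\<close> and
  wins.\<close>

lemma exists_period_gt_pi:
  obtains r where "0 < r" "pi < period r"
proof -
  have "\<forall>\<^sub>F r in at_top. pi < 2 * (1 + 1 / (1 + a * ln (1 + r\<^sup>2))) * arctan r"
    using a_pos by real_asymp
  then have "\<forall>\<^sub>F r in at_top. 0 < r \<and> pi < period r"
    using eventually_gt_at_top[of 0]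
    by eventually_elim (use period_lower_bound in \<open>auto intro: less_trans\<close>)
  then show thesis
    using that eventually_happens'[OF trivial_limit_at_top_linorder] by blast
qed

section \<open>Solutions\<close>

text \<open>The second-order equation enters only at the generator \<open>slope\<close>, whose
  derivative it expresses through \<open>exp (- a * u t)\<close> and \<open>u' t\<close>.\<close>

lemma jets_closed_under_deriv:
  assumes "flow u u'" "f \<in> jets u u'"
  shows "\<exists>f'\<in>jets u u'. \<forall>t. (f has_real_derivative f' t) (at t)"
  using assms(2)
proof (induction rule: jets.induct)
  case (const c)
  show ?case
    by (rule bexI[OF _ jets.const[of 0]]) simp
next
  case slope
  have "(\<lambda>t. (exp (- a * u t) + - 1) * (1 + u' t * u' t)) \<in> jets u u'"
    by (intro jets.intros)
  then show ?case
    using assms(1) by (intro bexI) (auto simp: flow_def power2_eq_square)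
next
  case (exp c)
  have "(\<lambda>t. exp (c * u t) * (c * u' t)) \<in> jets u u'"
    by (intro jets.intros)
  moreover have "((\<lambda>t. exp (c * u t)) has_real_derivative exp (c * u t) * (c * u' t)) (at t)" for t
  proof -
    have "(u has_real_derivative u' t) (at t)"
      using assms(1) by (simp add: flow_def)
    then show ?thesis
      by (auto intro!: derivative_eq_intros)
  qed
  ultimately show ?case
    by (intro bexI[of _ "\<lambda>t. exp (c * u t) * (c * u' t)"] allI)
next
  case (add f g)
  then obtain f' g' where "f' \<in> jets u u'" "g' \<in> jets u u'"
    and "\<And>t. (f has_real_derivative f' t) (at t)" "\<And>t. (g has_real_derivative g' t) (at t)"
    by blast
  then show ?case
    by (intro bexI[OF _ jets.add[of f' u u' g']]) (auto intro: DERIV_add)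
next
  case (mult f g)
  then obtain f' g' where f'g': "f' \<in> jets u u'" "g' \<in> jets u u'"
    and deriv: "\<And>t. (f has_real_derivative f' t) (at t)" "\<And>t. (g has_real_derivative g' t) (at t)"
    by blast
  have "(\<lambda>t. f' t * g t + g' t * f t) \<in> jets u u'"
    by (intro jets.add jets.mult f'g' mult)
  then show ?case
    by (rule bexI[rotated]) (intro allI DERIV_mult deriv)
qed

lemma smooth_exp_flow:
  assumes "flow u u'"
  shows "smooth (\<lambda>t. exp (u t))"
  using smooth_if_closed_under_deriv[OF jets_closed_under_deriv[OF assms] jets.exp[of 1]] by simp

lemma solution_flow:
  assumes "h \<in> solutions (- a)"
  shows "flow (\<lambda>t. ln (h t)) (\<lambda>t. deriv h t / h t)"
  unfolding flow_def
proof (intro allI conjI)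
  fix t
  have pos: "0 < h t"
    and eq: "h t powr (1 + a) * inverse ((deriv h t)\<^sup>2 + (h t)\<^sup>2) * (deriv (deriv h) t + h t) = 1"
    and diff: "\<And>j. j < 2 \<Longrightarrow> (deriv ^^ j) h differentiable (at t)"
    using assms by (auto simp: solutions_def C_class_def)
  have h: "(h has_real_derivative deriv h t) (at t)"
    using diff[of 0] by (simp add: DERIV_deriv_iff_real_differentiable)
  have h': "(deriv h has_real_derivative deriv (deriv h) t) (at t)"
    using diff[of 1] by (simp add: DERIV_deriv_iff_real_differentiable)
  show "((\<lambda>t. ln (h t)) has_real_derivative deriv h t / h t) (at t)"
    using pos h by (auto intro!: derivative_eq_intros simp: field_simps)
  define x y z v where "x = h t" and "y = deriv h t" and "z = deriv (deriv h) t"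
    and "v = exp (- a * ln (h t))"
  \<comment> \<open>\<open>v\<close> is \<open>x powr (- a)\<close>; this cancellation removes the
    real power from the equation.\<close>
  have "x powr (1 + a) * v = x"
    using pos by (simp add: x_def v_def powr_def flip: exp_add) (simp add: algebra_simps)
  moreover have "x powr (1 + a) * (z + x) = y\<^sup>2 + x\<^sup>2"
  proof -
    have "y\<^sup>2 + x\<^sup>2 \<noteq> 0"
      using pos by (simp add: x_def sum_power2_eq_zero_iff)
    then show ?thesis
      using eq unfolding x_def[symmetric] y_def[symmetric] z_def[symmetric] by (simp add: field_simps)
  qed
  ultimately have "x * (z + x) = v * (y\<^sup>2 + x\<^sup>2)"
    by (metis mult.assoc mult.commute)
  then have "z * x - y * y = (v - 1) * (x * x + y * y)"
    by (simp add: power2_eq_square algebra_simps)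
  also have "x * x + y * y = (1 + (y / x)\<^sup>2) * (x * x)"
    using pos by (simp add: x_def power2_eq_square field_simps)
  finally have "(z * x - y * y) / (x * x) = (v - 1) * (1 + (y / x)\<^sup>2)"
    using pos by (simp add: x_def)
  then show "((\<lambda>t. deriv h t / h t) has_real_derivative
      (exp (- a * ln (h t)) - 1) * (1 + (deriv h t / h t)\<^sup>2)) (at t)"
    using DERIV_divide[OF h' h] pos by (simp add: x_def y_def z_def v_def)
qed

lemma flow_solution:
  assumes "flow u u'" "\<And>t. u (t + 2 * pi) = u t"
  shows "(\<lambda>t. exp (u t)) \<in> solutions (- a)"
proof -
  define h where "h = (\<lambda>t. exp (u t))"
  have u: "(u has_real_derivative u' t) (at t)"
    and u': "(u' has_real_derivative (exp (- a * u t) - 1) * (1 + (u' t)\<^sup>2)) (at t)" for t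
    using assms(1) by (auto simp: flow_def)
  have "(h has_real_derivative h t * u' t) (at t)" for t
    unfolding h_def by (rule derivative_eq_intros u refl)+
  then have h': "deriv h = (\<lambda>t. h t * u' t)"
    and h: "\<And>t. (h has_real_derivative h t * u' t) (at t)"
    by (auto intro: DERIV_imp_deriv)
  have h'': "deriv (deriv h) t = h t * u' t * u' t + (exp (- a * u t) - 1) * (1 + (u' t)\<^sup>2) * h t" for t
    unfolding h' by (intro DERIV_imp_deriv DERIV_mult h u')
  have "h t powr (1 + a) * inverse ((deriv h t)\<^sup>2 + (h t)\<^sup>2) * (deriv (deriv h) t + h t) = 1" for t
  proof -
    define P where "P = 1 + (u' t)\<^sup>2"
    have P: "P \<noteq> 0" using one_plus_square_pos[of "u' t"] by (simp add: P_def)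
    have h_pos: "h t \<noteq> 0" by (simp add: h_def)
    have "(deriv h t)\<^sup>2 + (h t)\<^sup>2 = h t * h t * P"
      by (simp add: h' P_def power2_eq_square algebra_simps)
    moreover have "deriv (deriv h) t + h t = exp (- a * u t) * P * h t"
      unfolding h'' P_def by (simp add: power2_eq_square algebra_simps)
    moreover have "h t powr (1 + a) * exp (- a * u t) = h t"
      by (simp add: h_def powr_def algebra_simps flip: exp_add)
    moreover have "h t powr (1 + a) * inverse (h t * h t * P) * (exp (- a * u t) * P * h t)
        = h t powr (1 + a) * exp (- a * u t) * inverse (h t)"
      using P h_pos by (simp add: field_simps)
    ultimately show ?thesis
      using h_pos by simp
  qed
  moreover have "C_class 2 h"
    using smooth_exp_flow[OF assms(1)] by (simp add: smooth_def h_def)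
  moreover have "on_circle h"
    by (simp add: on_circle_def h_def assms(2))
  ultimately have "h \<in> solutions (- a)"
    by (simp add: solutions_def h_def)
  then show ?thesis
    by (simp add: h_def)
qed

section \<open>Nonconstant solutions as waves\<close>

definition wave :: "real \<Rightarrow> real \<Rightarrow> real" where
  "wave r t = exp (orbit r t)"

lemma smooth_wave: "smooth (wave r)"
  unfolding wave_def[abs_def] by (rule smooth_exp_flow[OF flow_orbit])

lemma wave_solution:
  assumes "2 * pi = real k * period r"
  shows "wave r \<in> solutions (- a)"
  unfolding wave_def[abs_def] by (rule flow_solution[OF flow_orbit]) (simp add: assms orbit_plus_period)

lemma solution_cases:
  assumes "h \<in> solutions (- a)"
  obtains "h = (\<lambda>_. 1)"
  | r k where "0 < r" "0 < k" "2 * pi = real k * period r" "(h, wave r) \<in> rotation"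
proof -
  have pos: "0 < h t" and periodic: "h (t + 2 * pi) = h t" for t
    using assms by (auto simp: solutions_def on_circle_def)
  obtain r t\<^sub>0 where r: "0 \<le> r" and orbit: "\<And>t. ln (h t) = orbit r (t + t\<^sub>0)"
    using flow_is_orbit[OF solution_flow[OF assms]] by blast
  have h: "h t = wave r (t + t\<^sub>0)" for t
    unfolding wave_def by (metis exp_ln orbit pos)
  show thesis
  proof (cases "r = 0")
    case True
    then have "h = (\<lambda>_. 1)"
      by (intro ext) (simp add: h wave_def orbit_def)
    then show thesis by (rule that(1))
  next
    case False
    have "orbit r (2 * pi) = orbit r 0"
      using orbit[of "2 * pi - t\<^sub>0"] orbit[of "- t\<^sub>0"] periodic[of "- t\<^sub>0"] by (simp add: add.commute)
    with False r obtain k where "0 < k" "2 * pi = real k * period r"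
      by (metis less_le orbit_periodic_imp pi_gt_zero zero_less_mult_iff zero_less_numeral)
    moreover have "\<forall>t. wave r t = h (t + - t\<^sub>0)"
      by (simp add: h)
    then have "(h, wave r) \<in> rotation"
      unfolding rotation_def by blast
    ultimately show thesis
      using that(2)[of r k] False r by simp
  qed
qed

lemma wave_not_constant:
  assumes "0 < r"
  shows "\<not> wave r constant_on UNIV"
proof
  assume "wave r constant_on UNIV"
  \<comment> \<open>These times correspond to the angles 0 and \<open>pi\<close>, where the
    coordinates are \<open>r\<close> and \<open>- r\<close>.\<close>
  then have "wave r 0 = wave r (clock r pi)"
    unfolding constant_on_def by (metis UNIV_I)
  then show False
    using height_pos[OF assms] height_neg[of "- r"] assms by (simp add: wave_def orbit_def)
qed

text \<open>A wave attains its maximum at time 0, with coordinate equal to its radius; rotations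
  preserve the maximum and hence the radius.\<close>

lemma rotation_wave_le:
  assumes "(wave r, wave s) \<in> rotation" "0 \<le> r"
  shows "s \<le> r"
proof -
  obtain c where c: "wave s 0 = wave r (0 + c)"
    using assms(1) unfolding rotation_def by blast
  then have "height s = height (r * cos (angle r c))"
    by (simp add: wave_def orbit_def)
  then have "s = r * cos (angle r c)"
    by (metis coord_height)
  also have "\<dots> \<le> r"
    using assms(2) by (intro mult_left_le) auto
  finally show ?thesis .
qed

lemma rotation_wave_imp_eq:
  assumes "(wave r, wave s) \<in> rotation" "0 \<le> r" "0 \<le> s"
  shows "r = s"
proof -
  have "(wave s, wave r) \<in> rotation"
    using equiv_rotation assms(1) by (meson equivE symE)
  then show ?thesis
    using rotation_wave_le assms by (metis order_antisym)
qed

section \<open>Existence and counting of solutions\<close>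

lemma period_IVT:
  assumes "period r\<^sub>1 \<le> y" "y \<le> period r\<^sub>2" "0 \<le> r\<^sub>1" "0 \<le> r\<^sub>2" "y \<noteq> 2 * pi / sqrt a"
  obtains r where "0 < r" "period r = y"
proof -
  have "\<exists>r. 0 \<le> r \<and> period r = y"
  proof (cases "r\<^sub>1 \<le> r\<^sub>2")
    case True
    then show ?thesis
      using IVT'[OF assms(1,2) True continuous_on_period] assms(3) by (metis order_trans)
  next
    case False
    then show ?thesis
      using IVT2'[OF assms(1,2) _ continuous_on_period] assms(4) by (metis nle_le order_trans)
  qed
  \<comment> \<open>At radius 0 the period is the excluded value \<open>2 * pi / sqrt a\<close>, so
    \<open>r\<close> is positive.\<close>
  then show thesis
    using that period_0 assms(5) by (metis less_le)
qed

text \<open>The period exceeds \<open>2 * pi\<close> at radius 0 and drops below it later, so it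
  takes this value. A period above \<open>pi\<close> fits only once into \<open>2 * pi\<close>, and
  strict monotonicity makes the radius unique.\<close>

lemma two_classes:
  assumes "a < 1"
  shows "\<exists>r>0. wave r \<in> solutions (- a) \<and>
    solutions (- a) // rotation = {rotation `` {\<lambda>_. 1}, rotation `` {wave r}}"
proof -
  have "1 * (2 * pi) < 2 * pi / sqrt a"
    using assms a_pos by (simp add: less_divide_eq)
  moreover obtain r\<^sub>1 where "0 < r\<^sub>1" "period r\<^sub>1 < 2 * pi"
    using exists_period_less_2pi assms less_imp_le by blast
  ultimately obtain r where r: "0 < r" "period r = 2 * pi"
    using period_IVT[of r\<^sub>1 "2 * pi" 0] period_0 by force
  have wave: "wave r \<in> solutions (- a)"
    using wave_solution[of 1 r] r by simp
  have cases: "h = (\<lambda>_. 1) \<or> (h, wave r) \<in> rotation" if h: "h \<in> solutions (- a)" for h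
    using h
  proof (cases rule: solution_cases)
    case (2 s k)
    have "pi < period s"
      using assms 2(1) by (intro period_gt_pi) auto
    then have "real k * pi < real k * period s"
      using 2(2) by simp
    also have "\<dots> = 2 * pi"
      using 2(3) by simp
    finally have "k = 1"
      using 2(2) by simp
    then have "period s = 2 * pi"
      using 2(3) by simp
    then have "s = r"
      using period_strict_antimono[of s r] period_strict_antimono[of r s] assms r 2(1)
      by (cases s r rule: linorder_cases) auto
    then show ?thesis using 2 by simp
  qed simp
  have "solutions (- a) // rotation = {rotation `` {\<lambda>_. 1}, rotation `` {wave r}}"
  proof
    show "solutions (- a) // rotation \<subseteq> {rotation `` {\<lambda>_. 1}, rotation `` {wave r}}"
      unfolding quotient_def using cases equiv_class_eq[OF equiv_rotation] by fastforce
    show "{rotation `` {\<lambda>_. 1}, rotation `` {wave r}} \<subseteq> solutions (- a) // rotation"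
      using quotientI[OF one_in_solutions] quotientI[OF wave] by blast
  qed
  then show ?thesis
    using r wave by blast
qed

text \<open>For positive radius the period lies strictly between \<open>pi\<close> and
  \<open>2 * pi\<close>, so no multiple of it equals \<open>2 * pi\<close>.\<close>

lemma only_constant:
  assumes "1 \<le> a" "a \<le> 4"
  shows "solutions (- a) = {\<lambda>_. 1}"
proof -
  have "h = (\<lambda>_. 1)" if h: "h \<in> solutions (- a)" for h
    using h
  proof (cases rule: solution_cases)
    case (2 r k)
    have "period r < 2 * pi" "pi < period r"
      using assms 2(1) by (auto intro: period_less_2pi period_gt_pi)
    then have "k \<noteq> 1" "real k * pi < 2 * pi"
      using 2(2,3) by auto
    then show ?thesis using 2(2) by simp
  qed
  then show ?thesis
    using one_in_solutions by blast
qed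

text \<open>For \<open>2 \<le> k < sqrt a\<close> the value \<open>2 * pi / k\<close> lies above the
  period \<open>2 * pi / sqrt a\<close> at radius 0 and does not exceed \<open>pi\<close>, which
  some period surpasses. Different \<open>k\<close> give different periods, hence different
  radii.\<close>

lemma many_waves:
  assumes "4 < a"
  shows "\<exists>H. H \<subseteq> {h \<in> solutions (- a). smooth h \<and> \<not> h constant_on UNIV} \<and> finite H \<and>
    pairwise (\<lambda>g h. (g, h) \<notin> rotation) H \<and> int (card H) \<ge> \<lceil>sqrt a\<rceil> - 2"
proof -
  \<comment> \<open>\<open>\<lceil>sqrt a\<rceil> - 1\<close> is the largest integer strictly below
    \<open>sqrt a\<close>; starting at 2 leaves \<open>\<lceil>sqrt a\<rceil> - 2\<close>
    indices.\<close>
  define K where "K = {2..nat (\<lceil>sqrt a\<rceil> - 1)}"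
  have "\<exists>r>0. period r = 2 * pi / real k" if "k \<in> K" for k
  proof -
    have k: "2 \<le> k" "real k < sqrt a"
      using that by (auto simp: K_def le_nat_iff) linarith+
    obtain r\<^sub>2 where "0 < r\<^sub>2" "pi < period r\<^sub>2"
      by (rule exists_period_gt_pi)
    moreover have "2 * pi / sqrt a < 2 * pi / real k"
      using k a_pos by (intro divide_strict_left_mono mult_pos_pos) auto
    moreover have "2 * pi / real k \<le> 2 * pi / 2"
      using k by (intro divide_left_mono) auto
    ultimately show ?thesis
      using period_IVT[of 0 "2 * pi / real k" r\<^sub>2] period_0 by force
  qed
  then obtain \<rho> where \<rho>: "\<And>k. k \<in> K \<Longrightarrow> 0 < \<rho> k" "\<And>k. k \<in> K \<Longrightarrow> period (\<rho> k) = 2 * pi / real k"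
    by metis
  have K_pos: "0 < k" if "k \<in> K" for k
    using that by (auto simp: K_def)
  have eq: "j = k" if "j \<in> K" "k \<in> K" "(wave (\<rho> j), wave (\<rho> k)) \<in> rotation" for j k
  proof -
    have "\<rho> j = \<rho> k"
      using rotation_wave_imp_eq[OF that(3)] \<rho>(1) that(1,2) by (simp add: less_imp_le)
    then have "2 * pi / real j = 2 * pi / real k"
      using \<rho>(2) that(1,2) by metis
    then show ?thesis
      using K_pos that(1,2) by (simp add: field_simps)
  qed
  define H where "H = (\<lambda>k. wave (\<rho> k)) ` K"
  have refl: "(f, f) \<in> rotation" for f
    using equiv_rotation by (meson UNIV_I equivE refl_onD)
  have "inj_on (\<lambda>k. wave (\<rho> k)) K"
    by (rule inj_onI) (metis eq refl)
  then have "card H = card K"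
    by (simp add: H_def card_image)
  then have "int (card H) \<ge> \<lceil>sqrt a\<rceil> - 2"
    by (simp add: K_def)
  moreover have "H \<subseteq> {h \<in> solutions (- a). smooth h \<and> \<not> h constant_on UNIV}"
  proof -
    have "wave (\<rho> k) \<in> solutions (- a)" if "k \<in> K" for k
      by (rule wave_solution[of k]) (use that \<rho>(2) K_pos in \<open>simp add: field_simps\<close>)
    then show ?thesis
      using \<rho>(1) by (auto simp: H_def smooth_wave wave_not_constant)
  qed
  moreover have "pairwise (\<lambda>g h. (g, h) \<notin> rotation) H"
    unfolding H_def pairwise_def using eq by blast
  moreover have "finite H"
    by (simp add: H_def K_def)
  ultimately show ?thesis by blast
qed

end

theorem theorem1p3:
  fixes p :: real
  shows
   "(-1 < p \<and> p < 0 \<longrightarrow>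
       card (solutions p // rotation) = 2 \<and>
       (\<exists>h\<in>solutions p. smooth h \<and> \<not> h constant_on UNIV \<and>
          solutions p // rotation = {rotation `` {\<lambda>_. 1}, rotation `` {h}})) \<and>
    (-4 \<le> p \<and> p \<le> -1 \<longrightarrow> solutions p = {\<lambda>_. 1}) \<and>
    (p < -4 \<longrightarrow>
       (\<exists>H. H \<subseteq> {h \<in> solutions p. smooth h \<and> \<not> h constant_on UNIV} \<and> finite H \<and>
          pairwise (\<lambda>g h. (g, h) \<notin> rotation) H \<and>
          int (card H) \<ge> \<lceil>sqrt (- p)\<rceil> - 2))"
proof (cases "p < 0")
  case True
  \<comment> \<open>Each of the three ranges of \<open>p\<close> lies in \<open>p < 0\<close>, where
    \<open>a = - p\<close> is admissible.\<close>
  then interpret oscillator "- p"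
    by unfold_locales simp
  have "card (solutions p // rotation) = 2 \<and>
       (\<exists>h\<in>solutions p. smooth h \<and> \<not> h constant_on UNIV \<and>
          solutions p // rotation = {rotation `` {\<lambda>_. 1}, rotation `` {h}})" if "- 1 < p"
  proof -
    obtain r where r: "0 < r" "wave r \<in> solutions p"
      and classes: "solutions p // rotation = {rotation `` {\<lambda>_. 1}, rotation `` {wave r}}"
      using two_classes \<open>- 1 < p\<close> by auto
    \<comment> \<open>A rotation of a constant function is constant, so the two classes are distinct
      and the count is exactly 2.\<close>
    have "rotation `` {\<lambda>_. 1} \<noteq> rotation `` {wave r}"
    proof
      assume "rotation `` {\<lambda>_. 1} = rotation `` {wave r}"
      then have "(\<lambda>_. 1, wave r) \<in> rotation"
        using equiv_rotation by (metis UNIV_I eq_equiv_class_iff)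
      then have "wave r constant_on UNIV"
        by (auto simp: rotation_def constant_on_def)
      then show False
        using wave_not_constant[OF r(1)] by blast
    qed
    then have "card (solutions p // rotation) = 2"
      by (simp add: classes)
    then show ?thesis
      using r classes smooth_wave wave_not_constant by blast
  qed
  then show ?thesis
    using only_constant many_waves by auto
qed auto

end
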